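(* There exists an $\omega$-model of $\mathsf{WSRRT}^2_2$ (together with $\mathsf{RCA}_0$) having only low sets.
   Context: An $\omega$-model is a structure of second-order arithmetic whose first-order part is the standard natural numbers; it is identified with its second-order part, a collection of subsets of $\mathbb{N}$. It is a model of $\mathsf{RCA}_0$ iff this collection is closed under Turing reducibility and effective join (a Turing ideal). A set $A$ is low if $A'\le_T\emptyset'$. A coloring $f:[\mathbb{N}]^2\to\mathbb{N}$ (defined on pairs $x<s$) is 2-bounded if $|f^{-1}(y)|\le2$ for every $y$. It is weakly rainbow-stable if for all $x,y$, either $f(x,s)=f(y,s)$ for all but finitely many $s$, or $f(x,s)\neq f(y,s)$ for all but finitely many $s$. A set $R$ is a rainbow for $f$ if $f$ is injective on $[R]^2$. $\mathsf{WSRRT}^2_2$ is the statement "every weakly rainbow-stable 2-bounded coloring $f:[\mathbb{N}]^2\to\mathbb{N}$ has an infinite rainbow". *)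

theory Defs
  imports Main "HOL-Library.Nat_Bijection"
begin

section \<open>Computability relative to a set\<close>

text \<open>
  Programs for the unary partial functions that are partial recursive in a set of natural
  numbers.  Functions of several arguments are handled through the Cantor pairing
  \<^const>\<open>prod_encode\<close>, so \<open>CFst\<close> and \<open>CSnd\<close> play the role of the projections and
  \<open>CPair CFst CSnd\<close> is the identity.
\<close>

datatype code =
    CZero
  | CSucc
  | CFst
  | CSnd
  | COracle
  | CPair code code
  | CComp code code
  | CPrec code code
  | CMu code

text \<open>
  \<open>computes A c x y\<close>: with access to \<open>A\<close>, program \<open>c\<close> halts on input \<open>x\<close> with output \<open>y\<close>.
  \<open>CComp c d\<close> runs \<open>d\<close> first; \<open>CMu c\<close> is unbounded search, which requires \<open>c\<close> to
  converge at all arguments below the least zero.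
\<close>

inductive computes :: "nat set \<Rightarrow> code \<Rightarrow> nat \<Rightarrow> nat \<Rightarrow> bool" for A :: "nat set" where
  zero: "computes A CZero x 0"
| succ: "computes A CSucc x (Suc x)"
| fst: "computes A CFst (prod_encode (x, y)) x"
| snd: "computes A CSnd (prod_encode (x, y)) y"
| query: "computes A COracle x (if x \<in> A then 1 else 0)"
| pair: "computes A c x y \<Longrightarrow> computes A d x z \<Longrightarrow>
    computes A (CPair c d) x (prod_encode (y, z))"
| comp: "computes A d x y \<Longrightarrow> computes A c y z \<Longrightarrow> computes A (CComp c d) x z"
| prec_0: "computes A c a y \<Longrightarrow> computes A (CPrec c d) (prod_encode (a, 0)) y"
| prec_Suc: "computes A (CPrec c d) (prod_encode (a, n)) y \<Longrightarrow>
    computes A d (prod_encode (a, prod_encode (n, y))) z \<Longrightarrow>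
    computes A (CPrec c d) (prod_encode (a, Suc n)) z"
| mu: "computes A c (prod_encode (a, n)) 0 \<Longrightarrow>
    (\<forall>m<n. \<exists>k. computes A c (prod_encode (a, m)) (Suc k)) \<Longrightarrow>
    computes A (CMu c) a n"

lemma computes_deterministic:
  "computes A c x y \<Longrightarrow> computes A c x z \<Longrightarrow> y = z"
proof (induction arbitrary: z rule: computes.induct)
  case (pair c x y d w)
  from pair.prems show ?case
    by cases (use pair.IH in auto)
next
  case (comp d x y c w)
  from comp.prems show ?case
    by cases (use comp.IH in auto)
next
  case (prec_0 c a y d)
  from prec_0.prems show ?case
    by cases (use prec_0.IH in auto)
next
  case (prec_Suc c d a n y w)
  from prec_Suc.prems show ?case
    by cases (use prec_Suc.IH in auto)
next
  case (mu c a n)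
  from mu.prems show ?case
  proof cases
    case mu
    with mu.IH show ?thesis
      by (metis linorder_neqE_nat nat.distinct(1))
  qed
qed (auto elim: computes.cases)

primrec code_number :: "code \<Rightarrow> nat" where
  "code_number CZero = prod_encode (0, 0)"
| "code_number CSucc = prod_encode (1, 0)"
| "code_number CFst = prod_encode (2, 0)"
| "code_number CSnd = prod_encode (3, 0)"
| "code_number COracle = prod_encode (4, 0)"
| "code_number (CPair c d) = prod_encode (5, prod_encode (code_number c, code_number d))"
| "code_number (CComp c d) = prod_encode (6, prod_encode (code_number c, code_number d))"
| "code_number (CPrec c d) = prod_encode (7, prod_encode (code_number c, code_number d))"
| "code_number (CMu c) = prod_encode (8, code_number c)"

lemma inj_code_number: "inj code_number"
proof (rule injI)
  show "code_number c = code_number d \<Longrightarrow> c = d" for c d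
    by (induction c arbitrary: d) (case_tac d; simp)+
qed

text \<open>
  The graph of the \<open>e\<close>-th partial function recursive in \<open>A\<close>; it is nowhere defined when
  \<open>e\<close> is not the number of a program.
\<close>

definition Phi :: "nat set \<Rightarrow> nat \<Rightarrow> nat \<Rightarrow> nat \<Rightarrow> bool" where
  "Phi A e x y \<longleftrightarrow> (\<exists>c. code_number c = e \<and> computes A c x y)"

definition turing_le :: "nat set \<Rightarrow> nat set \<Rightarrow> bool" (infix "\<le>\<^sub>T" 50) where
  "B \<le>\<^sub>T A \<longleftrightarrow> (\<exists>e. \<forall>x. Phi A e x (if x \<in> B then 1 else 0))"

definition jump :: "nat set \<Rightarrow> nat set" where
  "jump A = {e. \<exists>y. Phi A e e y}"

definition low :: "nat set \<Rightarrow> bool" where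
  "low A \<longleftrightarrow> jump A \<le>\<^sub>T jump {}"

definition join :: "nat set \<Rightarrow> nat set \<Rightarrow> nat set" where
  "join A B = {2 * n | n. n \<in> A} \<union> {2 * n + 1 | n. n \<in> B}"


section \<open>\<open>\<omega>\<close>-models\<close>

text \<open>
  An \<open>\<omega>\<close>-model is identified with its second-order part, and it is a model of \<open>RCA\<^sub>0\<close> iff
  that collection is a Turing ideal.
\<close>

definition turing_ideal :: "nat set set \<Rightarrow> bool" where
  "turing_ideal M \<longleftrightarrow> M \<noteq> {} \<and>
     (\<forall>A\<in>M. \<forall>B. B \<le>\<^sub>T A \<longrightarrow> B \<in> M) \<and>
     (\<forall>A\<in>M. \<forall>B\<in>M. join A B \<in> M)"

definition omega_model_RCA0 :: "nat set set \<Rightarrow> bool" where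
  "omega_model_RCA0 M \<longleftrightarrow> turing_ideal M"


section \<open>Rainbows for weakly rainbow-stable colorings\<close>

text \<open>
  Pairs in \<open>[R]\<^sup>2\<close> are written in increasing order.  A coloring is a curried function of
  which only the values \<open>f x s\<close> with \<open>x < s\<close> are meaningful: none of the following
  notions depends on the other values.
\<close>

definition pairs :: "nat set \<Rightarrow> (nat \<times> nat) set" where
  "pairs R = {(x, s). x \<in> R \<and> s \<in> R \<and> x < s}"

definition two_bounded :: "(nat \<Rightarrow> nat \<Rightarrow> nat) \<Rightarrow> bool" where
  "two_bounded f \<longleftrightarrow>
     (\<forall>y. finite {(x, s) \<in> pairs UNIV. f x s = y} \<and>
          card {(x, s) \<in> pairs UNIV. f x s = y} \<le> 2)"

definition weakly_rainbow_stable :: "(nat \<Rightarrow> nat \<Rightarrow> nat) \<Rightarrow> bool" where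
  "weakly_rainbow_stable f \<longleftrightarrow>
     (\<forall>x y. finite {s. x < s \<and> y < s \<and> f x s \<noteq> f y s} \<or>
            finite {s. x < s \<and> y < s \<and> f x s = f y s})"

definition rainbow :: "(nat \<Rightarrow> nat \<Rightarrow> nat) \<Rightarrow> nat set \<Rightarrow> bool" where
  "rainbow f R \<longleftrightarrow> inj_on (\<lambda>(x, s). f x s) (pairs R)"

text \<open>The set of natural numbers that represents a coloring in second-order arithmetic.\<close>

definition coloring_set :: "(nat \<Rightarrow> nat \<Rightarrow> nat) \<Rightarrow> nat set" where
  "coloring_set f = {prod_encode (prod_encode (x, s), f x s) | x s. (x, s) \<in> pairs UNIV}"

text \<open>
  Satisfaction of \<open>WSRRT\<^sup>2\<^sub>2\<close> in an \<open>\<omega>\<close>-model: set quantifiers range over \<open>M\<close>, while the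
  arithmetical notions above are absolute because the numbers are standard.
\<close>

definition models_WSRRT22 :: "nat set set \<Rightarrow> bool" where
  "models_WSRRT22 M \<longleftrightarrow>
     (\<forall>f. coloring_set f \<in> M \<and> two_bounded f \<and> weakly_rainbow_stable f \<longrightarrow>
          (\<exists>R\<in>M. infinite R \<and> rainbow f R))"

end

theory Submission
  imports Defs
begin

text \<open>
  Let \<open>f\<close> be a coloring computable in \<open>X\<close>. Call a finite rainbow \<open>F\<close> good if no two of its elements
  eventually get the same color; almost all one-point end extensions of a good \<open>F\<close> are rainbows, and by
  2-boundedness at most \<open>card F\<close> of those are not good. An infinite rainbow \<open>R\<close> with
  \<open>(X \<oplus> R)' \<le> X'\<close> is built by bushy tree forcing. Goodness is decidable in \<open>X'\<close>, but whether a good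
  extension forces the \<open>e\<close>-th program to halt is not; instead one asks the \<open>\<Sigma>\<^sub>1(X)\<close> question whether
  such extensions are the leaves of a tree of rainbows that branches widely. If so, some leaf is good
  and still escapes every earlier negative commitment. If not, the \<open>e\<close>-th program joins the
  commitments, and the set to be avoided stays small with a larger branching factor, because a union
  of an \<open>m\<close>-small and an \<open>n\<close>-small set is \<open>(m + n)\<close>-small. So \<open>X'\<close> carries out the construction
  and knows the jump of \<open>X \<oplus> R\<close>. Iterating over all colorings that appear along the way gives an
  increasing chain of low sets, whose lower cone is the model.
\<close>

section \<open>Total functions and decidable predicates relative to an oracle\<close>

abbreviation pr :: "nat \<Rightarrow> nat \<Rightarrow> nat" where
  "pr a b \<equiv> prod_encode (a, b)"

definition pi1 :: "nat \<Rightarrow> nat" where "pi1 n = fst (prod_decode n)"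

definition pi2 :: "nat \<Rightarrow> nat" where "pi2 n = snd (prod_decode n)"

lemma pi_pr [simp]: "pi1 (pr a b) = a" "pi2 (pr a b) = b"
  by (simp_all add: pi1_def pi2_def)

lemma pr_pi [simp]: "pr (pi1 n) (pi2 n) = n"
  by (simp add: pi1_def pi2_def)

definition Rec :: "nat set \<Rightarrow> (nat \<Rightarrow> nat) \<Rightarrow> bool" where
  "Rec A f \<longleftrightarrow> (\<exists>c. \<forall>x. computes A c x (f x))"

definition Dec :: "nat set \<Rightarrow> (nat \<Rightarrow> bool) \<Rightarrow> bool" where
  "Dec A P \<longleftrightarrow> Rec A (\<lambda>x. of_bool (P x))"

text \<open>These closure rules follow the syntax of a term, so \<open>intro rec_intros\<close>
  proves most computability claims. A relation of several arguments enters as a predicate of one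
  number \<open>z\<close> that is unpacked by \<open>pi1\<close> and \<open>pi2\<close>.\<close>

named_theorems rec_intros

lemma turing_le_iff_Dec: "B \<le>\<^sub>T A \<longleftrightarrow> Dec A (\<lambda>x. x \<in> B)"
  unfolding turing_le_def Phi_def Dec_def Rec_def of_bool_def
  by (metis injD inj_code_number)

lemma Rec_comp: "Rec A f \<Longrightarrow> Rec A g \<Longrightarrow> Rec A (\<lambda>x. f (g x))"
  unfolding Rec_def by (meson computes.comp)

lemma Rec_pr [rec_intros]: "Rec A f \<Longrightarrow> Rec A g \<Longrightarrow> Rec A (\<lambda>x. pr (f x) (g x))"
  unfolding Rec_def by (meson computes.pair)

lemma Rec_pi1 [rec_intros]: "Rec A f \<Longrightarrow> Rec A (\<lambda>x. pi1 (f x))"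
proof (rule Rec_comp[where f = pi1])
  show "Rec A pi1"
    unfolding Rec_def by (metis computes.fst pr_pi)
qed

lemma Rec_pi2 [rec_intros]: "Rec A f \<Longrightarrow> Rec A (\<lambda>x. pi2 (f x))"
proof (rule Rec_comp[where f = pi2])
  show "Rec A pi2"
    unfolding Rec_def by (metis computes.snd pr_pi)
qed

lemma Rec_Suc [rec_intros]: "Rec A f \<Longrightarrow> Rec A (\<lambda>x. Suc (f x))"
proof (rule Rec_comp[where f = Suc])
  show "Rec A Suc"
    unfolding Rec_def by (metis computes.succ)
qed

primrec const_code :: "nat \<Rightarrow> code" where
  "const_code 0 = CZero"
| "const_code (Suc n) = CComp CSucc (const_code n)"

lemma computes_const_code: "computes A (const_code n) x n"
  by (induction n) (auto intro: computes.intros)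

lemma Rec_const [rec_intros]: "Rec A (\<lambda>x. n)"
  unfolding Rec_def using computes_const_code by blast

lemma Rec_id [rec_intros]: "Rec A (\<lambda>x. x)"
proof -
  have "computes A (CPair CFst CSnd) x x" for x
    using computes.pair[OF computes.fst[of A "pi1 x" "pi2 x"] computes.snd[of A "pi1 x" "pi2 x"]]
    by simp
  then show ?thesis
    unfolding Rec_def by blast
qed

lemma Dec_oracle [rec_intros]: "Rec A f \<Longrightarrow> Dec A (\<lambda>x. f x \<in> A)"
  unfolding Dec_def
proof (rule Rec_comp[where f = "\<lambda>x. of_bool (x \<in> A)"])
  show "Rec A (\<lambda>x. of_bool (x \<in> A))"
    unfolding Rec_def of_bool_def by (metis computes.query)
qed

text \<open>The whole input \<open>x\<close> serves as the parameter of the recursion. The step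
  function is tested on coded triples of parameter, stage and previous value, the format in which
  \<open>CPrec\<close> feeds its second program.\<close>

lemma Rec_rec_nat [rec_intros]:
  assumes "Rec A g" "Rec A (\<lambda>z. h (pi1 z) (pi1 (pi2 z)) (pi2 (pi2 z)))" "Rec A b"
  shows "Rec A (\<lambda>x. rec_nat (g x) (h x) (b x))"
proof -
  obtain c d where c: "\<And>x. computes A c x (g x)"
    and d: "\<And>z. computes A d z (h (pi1 z) (pi1 (pi2 z)) (pi2 (pi2 z)))"
    using assms(1,2) unfolding Rec_def by blast
  have "computes A (CPrec c d) (pr x n) (rec_nat (g x) (h x) n)" for x n
  proof (induction n)
    case 0
    then show ?case by (simp add: c computes.prec_0)
  next
    case (Suc n)
    show ?case
      using computes.prec_Suc[OF Suc d] by simp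
  qed
  then have "computes A (CPrec c d) z (rec_nat (g (pi1 z)) (h (pi1 z)) (pi2 z))" for z
    by (metis pr_pi)
  then have "Rec A (\<lambda>z. rec_nat (g (pi1 z)) (h (pi1 z)) (pi2 z))"
    unfolding Rec_def by blast
  from Rec_comp[OF this Rec_pr[OF Rec_id assms(3)]] show ?thesis by simp
qed

lemma Rec_add [rec_intros]:
  assumes "Rec A f" "Rec A g" shows "Rec A (\<lambda>x. f x + g x)"
proof -
  have "rec_nat m (\<lambda>n r. Suc r) n = m + n" for m n
    by (induction n) auto
  moreover have "Rec A (\<lambda>x. rec_nat (f x) (\<lambda>n r. Suc r) (g x))"
    using assms by (intro rec_intros)
  ultimately show ?thesis by simp
qed

text \<open>Bounded sums carry much of what follows: a product is a constant sum, and bounded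
  quantifiers and cardinalities are sums of \<open>of_bool\<close>.\<close>

lemma Rec_sum [rec_intros]:
  assumes "Rec A (\<lambda>z. g (pi1 z) (pi2 z))" "Rec A b"
  shows "Rec A (\<lambda>x. \<Sum>y<b x. g x y)"
proof -
  have eq: "rec_nat 0 (\<lambda>n r. r + g x n) m = (\<Sum>y<m. g x y)" for x m
    by (induction m) auto
  have "Rec A (\<lambda>z. g (pi1 z) (pi1 (pi2 z)))"
    using Rec_comp[OF assms(1), of "\<lambda>z. pr (pi1 z) (pi1 (pi2 z))"]
    by (simp add: Rec_pr Rec_pi1 Rec_pi2 Rec_id)
  then have "Rec A (\<lambda>x. rec_nat 0 (\<lambda>n r. r + g x n) (b x))"
    using assms(2) by (intro rec_intros)
  then show ?thesis by (simp add: eq)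
qed

lemma Rec_mult [rec_intros]:
  assumes "Rec A f" "Rec A g" shows "Rec A (\<lambda>x. f x * g x)"
proof -
  have "Rec A (\<lambda>x. \<Sum>y<f x. g x)"
    using assms(1) by (intro rec_intros) (rule Rec_comp[OF assms(2) Rec_pi1[OF Rec_id]])
  then show ?thesis by simp
qed

lemma Rec_diff [rec_intros]:
  assumes "Rec A f" "Rec A g" shows "Rec A (\<lambda>x. f x - g x)"
proof -
  \<comment> \<open>The predecessor is the recursion that discards the previous value and returns
    the stage.\<close>
  have p: "rec_nat 0 (\<lambda>n r. n) m = m - 1" for m
    by (cases m) auto
  have "Rec A (\<lambda>x. rec_nat 0 (\<lambda>n r. n) x)"
    by (intro rec_intros)
  then have "Rec A (\<lambda>x. x - 1)" by (simp add: p)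
  then have P: "Rec A h \<Longrightarrow> Rec A (\<lambda>x. h x - 1)" for h
    by (rule Rec_comp)
  have "rec_nat m (\<lambda>n r. r - 1) n = m - n" for m n
    by (induction n) auto
  moreover have "Rec A (\<lambda>x. rec_nat (f x) (\<lambda>n r. r - 1) (g x))"
    using assms by (intro rec_intros P)
  ultimately show ?thesis by simp
qed

lemma Rec_power2 [rec_intros]:
  assumes "Rec A f" shows "Rec A (\<lambda>x. 2 ^ f x)"
proof -
  have "rec_nat 1 (\<lambda>n r. r + r) n = (2 :: nat) ^ n" for n
    by (induction n) auto
  moreover have "Rec A (\<lambda>x. rec_nat 1 (\<lambda>n r. r + r) (f x))"
    using assms by (intro rec_intros)
  ultimately show ?thesis by simp
qed

lemma Rec_of_bool [rec_intros]: "Dec A P \<Longrightarrow> Rec A (\<lambda>x. of_bool (P x))"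
  by (simp add: Dec_def)

lemma Dec_comp: "Dec A P \<Longrightarrow> Rec A f \<Longrightarrow> Dec A (\<lambda>x. P (f x))"
  unfolding Dec_def by (rule Rec_comp)

lemma Dec_comp2:
  assumes "Dec A (\<lambda>z. P (pi1 z) (pi2 z))" "Rec A f" "Rec A g"
  shows "Dec A (\<lambda>x. P (f x) (g x))"
  using Dec_comp[OF assms(1) Rec_pr[OF assms(2,3)]] by simp

lemma Dec_comp3:
  assumes "Dec A (\<lambda>z. P (pi1 z) (pi1 (pi2 z)) (pi2 (pi2 z)))" "Rec A f" "Rec A g" "Rec A h"
  shows "Dec A (\<lambda>x. P (f x) (g x) (h x))"
  using Dec_comp[OF assms(1) Rec_pr[OF assms(2) Rec_pr[OF assms(3,4)]]] by simp

lemma Dec_const [rec_intros]: "Dec A (\<lambda>x. b)"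
  unfolding Dec_def by (rule Rec_const)

lemma Dec_not [rec_intros]:
  assumes "Dec A P" shows "Dec A (\<lambda>x. \<not> P x)"
proof -
  have "Rec A (\<lambda>x. 1 - of_bool (P x))"
    using assms by (intro rec_intros)
  moreover have "1 - of_bool p = (of_bool (\<not> p) :: nat)" for p
    by simp
  ultimately show ?thesis
    unfolding Dec_def by (simp only:)
qed

lemma Dec_conj [rec_intros]:
  assumes "Dec A P" "Dec A Q" shows "Dec A (\<lambda>x. P x \<and> Q x)"
proof -
  have "Rec A (\<lambda>x. of_bool (P x) * of_bool (Q x))"
    using assms by (intro rec_intros)
  then show ?thesis
    unfolding Dec_def by (simp only: of_bool_conj)
qed

lemma Dec_disj [rec_intros]:
  assumes "Dec A P" "Dec A Q" shows "Dec A (\<lambda>x. P x \<or> Q x)"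
proof -
  have "Dec A (\<lambda>x. \<not> (\<not> P x \<and> \<not> Q x))"
    using assms by (intro rec_intros)
  then show ?thesis by simp
qed

lemma Dec_imp [rec_intros]:
  assumes "Dec A P" "Dec A Q" shows "Dec A (\<lambda>x. P x \<longrightarrow> Q x)"
proof -
  have "Dec A (\<lambda>x. \<not> P x \<or> Q x)"
    using assms by (intro rec_intros)
  then show ?thesis by (simp only: imp_conv_disj)
qed

lemma Dec_le [rec_intros]:
  assumes "Rec A f" "Rec A g" shows "Dec A (\<lambda>x. f x \<le> g x)"
proof -
  have "Rec A (\<lambda>x. 1 - (f x - g x))"
    using assms by (intro rec_intros)
  moreover have "1 - (m - n) = of_bool (m \<le> n)" for m n :: nat
    by auto
  ultimately show ?thesis
    unfolding Dec_def by simp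
qed

lemma Dec_less [rec_intros]:
  assumes "Rec A f" "Rec A g" shows "Dec A (\<lambda>x. f x < g x)"
  using Dec_le[OF Rec_Suc[OF assms(1)] assms(2)] by (simp add: Suc_le_eq)

lemma Dec_eq [rec_intros]:
  assumes "Rec A f" "Rec A g" shows "Dec A (\<lambda>x. f x = g x)"
proof -
  have "Dec A (\<lambda>x. f x \<le> g x \<and> g x \<le> f x)"
    using assms by (intro rec_intros)
  then show ?thesis by (simp only: order_eq_iff)
qed

lemma Dec_bex [rec_intros]:
  assumes "Dec A (\<lambda>z. P (pi1 z) (pi2 z))" "Rec A b"
  shows "Dec A (\<lambda>x. \<exists>y<b x. P x y)"
proof -
  have "Dec A (\<lambda>x. 0 < (\<Sum>y<b x. of_bool (P x y) :: nat))"
    using assms by (intro rec_intros)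
  moreover have "0 < (\<Sum>y<m. of_bool (P x y) :: nat) \<longleftrightarrow> (\<exists>y<m. P x y)" for x m
    by (auto simp: sum_pos2 zero_less_iff_neq_zero)
  ultimately show ?thesis by simp
qed

lemma Dec_ball [rec_intros]:
  assumes "Dec A (\<lambda>z. P (pi1 z) (pi2 z))" "Rec A b"
  shows "Dec A (\<lambda>x. \<forall>y<b x. P x y)"
proof -
  have "Dec A (\<lambda>x. \<not> (\<exists>y<b x. \<not> P x y))"
    using assms by (intro rec_intros)
  then show ?thesis by simp
qed

lemma Rec_if [rec_intros]:
  assumes "Dec A P" "Rec A f" "Rec A g" shows "Rec A (\<lambda>x. if P x then f x else g x)"
proof -
  have "Rec A (\<lambda>x. of_bool (P x) * f x + (1 - of_bool (P x)) * g x)"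
    using assms by (intro rec_intros)
  moreover have "of_bool p * m + (1 - of_bool p) * n = (if p then m else n)" for p and m n :: nat
    by simp
  ultimately show ?thesis by simp
qed

text \<open>\<open>CMu\<close> searches for a zero, hence the negation in \<open>c\<close>. Below
  the least witness the value is 1, a successor, as the rule \<open>mu\<close> demands.\<close>

lemma computes_CMu_Least:
  assumes c: "\<And>x y. computes A c (pr x y) (of_bool (\<not> P x y))" and ex: "\<exists>y. P x y"
  shows "computes A (CMu c) x (LEAST y. P x y)"
proof (rule computes.mu)
  show "computes A c (pr x (LEAST y. P x y)) 0"
    using c[of x "LEAST y. P x y"] LeastI_ex[OF ex] by simp
  show "\<forall>m<LEAST y. P x y. \<exists>k. computes A c (pr x m) (Suc k)"
  proof (intro allI impI)
    fix m assume "m < (LEAST y. P x y)"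
    then have "\<not> P x m" by (rule not_less_Least)
    then have "computes A c (pr x m) (Suc 0)"
      using c[of x m] by simp
    then show "\<exists>k. computes A c (pr x m) (Suc k)" ..
  qed
qed

lemma Rec_Least [rec_intros]:
  assumes "Dec A (\<lambda>z. P (pi1 z) (pi2 z))" and ex: "\<And>x. \<exists>y. P x y"
  shows "Rec A (\<lambda>x. LEAST y. P x y)"
proof -
  have "Rec A (\<lambda>z. of_bool (\<not> P (pi1 z) (pi2 z)))"
    using assms(1) by (intro rec_intros)
  then obtain c where "\<And>z. computes A c z (of_bool (\<not> P (pi1 z) (pi2 z)))"
    unfolding Rec_def by blast
  then have "computes A c (pr x y) (of_bool (\<not> P x y))" for x y
    by (metis pi_pr)
  then have "computes A (CMu c) x (LEAST y. P x y)" for x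
    by (rule computes_CMu_Least) (rule ex)
  then show ?thesis
    unfolding Rec_def by blast
qed

text \<open>The quotient is found by unbounded search; positivity of the divisor makes the search
  total.\<close>

lemma Rec_div:
  assumes "Rec A f" "Rec A g" "\<And>x. 0 < g x" shows "Rec A (\<lambda>x. f x div g x)"
proof -
  have "Rec A (\<lambda>x. LEAST q. f x < Suc q * g x)"
  proof (intro rec_intros)
    show "Rec A (\<lambda>z. f (pi1 z))" "Rec A (\<lambda>z. g (pi1 z))"
      by (rule Rec_comp[OF assms(1) Rec_pi1[OF Rec_id]] Rec_comp[OF assms(2) Rec_pi1[OF Rec_id]])+
    show "\<exists>y. f x < Suc y * g x" for x
      using dividend_less_div_times[OF assms(3)] by (intro exI[of _ "f x div g x"]) simp
  qed
  moreover have "(LEAST q. f x < Suc q * g x) = f x div g x" for x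
  proof (rule Least_equality)
    show "f x < Suc (f x div g x) * g x"
      using dividend_less_div_times[OF assms(3)] by simp
    show "f x div g x \<le> q" if "f x < Suc q * g x" for q
      using less_mult_imp_div_less[OF that] by simp
  qed
  ultimately show ?thesis by simp
qed

lemma Rec_div2 [rec_intros]: "Rec A f \<Longrightarrow> Rec A (\<lambda>x. f x div 2)"
  by (intro Rec_div rec_intros) auto

lemma Dec_even [rec_intros]:
  assumes "Rec A f" shows "Dec A (\<lambda>x. even (f x))"
proof -
  have "Dec A (\<lambda>x. 2 * (f x div 2) = f x)"
    using assms by (intro rec_intros)
  moreover have "2 * (n div 2) = n \<longleftrightarrow> even n" for n :: nat
    by presburger
  ultimately show ?thesis by simp
qed

section \<open>Finite sets given by canonical indices\<close>

lemma Dec_set_decode [rec_intros]: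
  assumes "Rec A f" "Rec A g" shows "Dec A (\<lambda>x. f x \<in> set_decode (g x))"
proof -
  have "Dec A (\<lambda>x. \<not> even (g x div 2 ^ f x))"
    using assms by (intro rec_intros Rec_div) auto
  then show ?thesis by (simp add: set_decode_def)
qed

definition ins :: "nat \<Rightarrow> nat \<Rightarrow> nat" where
  "ins x S = (if x \<in> set_decode S then S else S + 2 ^ x)"

lemma Rec_ins [rec_intros]:
  assumes "Rec A f" "Rec A g" shows "Rec A (\<lambda>x. ins (f x) (g x))"
  unfolding ins_def using assms by (intro rec_intros)

lemma set_decode_ins [simp]: "set_decode (ins x S) = insert x (set_decode S)"
proof (cases "x \<in> set_decode S")
  case False
  then have "ins x S = set_encode (insert x (set_decode S))"
    by (simp add: ins_def)
  then show ?thesis by simp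
qed (auto simp: ins_def)

text \<open>This turns quantifiers over a coded finite set into quantifiers bounded by its
  index.\<close>

lemma set_decode_less: "x \<in> set_decode S \<Longrightarrow> x < S"
proof -
  assume "x \<in> set_decode S"
  then have "S div 2 ^ x \<noteq> 0" by (auto simp: set_decode_def intro!: Nat.gr0I)
  then have "2 ^ x \<le> S" by (metis div_less not_le)
  then show "x < S" by (meson less_exp order_less_le_trans)
qed

text \<open>Every oracle query is replaced by a call of the program that decides \<open>A\<close>.
  Only convergent computations have to carry over, because \<open>Rec\<close> speaks of total
  functions.\<close>

lemma Rec_trans:
  assumes "Rec A f" "A \<le>\<^sub>T B" shows "Rec B f"
proof -
  obtain d where d: "\<And>x. computes B d x (if x \<in> A then 1 else 0)"
    using assms(2) unfolding turing_le_def Phi_def by (metis injD inj_code_number)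
  have "\<exists>c'. \<forall>x y. computes A c x y \<longrightarrow> computes B c' x y" for c
  proof (induction c)
    case CZero
    then show ?case by (intro exI[of _ CZero]) (auto elim: computes.cases intro: computes.intros)
  next
    case CSucc
    then show ?case by (intro exI[of _ CSucc]) (auto elim: computes.cases intro: computes.intros)
  next
    case CFst
    then show ?case by (intro exI[of _ CFst]) (auto elim: computes.cases intro: computes.intros)
  next
    case CSnd
    then show ?case by (intro exI[of _ CSnd]) (auto elim: computes.cases intro: computes.intros)
  next
    case COracle
    have "computes A COracle x y \<Longrightarrow> computes B d x y" for x y
      by (erule computes.cases) (use d in auto)
    then show ?case by blast
  next
    case (CPair c1 c2)
    then obtain c1' c2' where
      "\<forall>x y. computes A c1 x y \<longrightarrow> computes B c1' x y"
      "\<forall>x y. computes A c2 x y \<longrightarrow> computes B c2' x y" by blast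
    then have "computes A (CPair c1 c2) x y \<Longrightarrow> computes B (CPair c1' c2') x y" for x y
      by (erule_tac computes.cases) (auto intro: computes.pair)
    then show ?case by blast
  next
    case (CComp c1 c2)
    then obtain c1' c2' where
      "\<forall>x y. computes A c1 x y \<longrightarrow> computes B c1' x y"
      "\<forall>x y. computes A c2 x y \<longrightarrow> computes B c2' x y" by blast
    then have "computes A (CComp c1 c2) x y \<Longrightarrow> computes B (CComp c1' c2') x y" for x y
      by (erule_tac computes.cases) (simp_all, blast intro: computes.comp)
    then show ?case by blast
  next
    case (CPrec c1 c2)
    then obtain c1' c2' where c:
      "\<forall>x y. computes A c1 x y \<longrightarrow> computes B c1' x y"
      "\<forall>x y. computes A c2 x y \<longrightarrow> computes B c2' x y" by blast
    \<comment> \<open>A recursion calls itself, so the argument is an induction on the computation,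
      with the program kept fixed by an equation.\<close>
    have "computes A c x y \<Longrightarrow> c = CPrec c1 c2 \<Longrightarrow> computes B (CPrec c1' c2') x y" for c x y
      by (induction rule: computes.induct)
        (use c in \<open>auto intro: computes.prec_0 computes.prec_Suc\<close>)
    then show ?case by blast
  next
    case (CMu c)
    then obtain c' where c: "\<forall>x y. computes A c x y \<longrightarrow> computes B c' x y" by blast
    have "computes B (CMu c') x y" if "computes A (CMu c) x y" for x y
      using that by cases (use c in \<open>auto intro!: computes.mu; blast\<close>)
    then show ?case by blast
  qed
  then show ?thesis
    using assms(1) unfolding Rec_def by meson
qed

lemma Dec_trans: "Dec A P \<Longrightarrow> A \<le>\<^sub>T B \<Longrightarrow> Dec B P"
  unfolding Dec_def by (rule Rec_trans)

lemma turing_le_trans: "A \<le>\<^sub>T B \<Longrightarrow> B \<le>\<^sub>T C \<Longrightarrow> A \<le>\<^sub>T C"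
  unfolding turing_le_iff_Dec[of A] by (rule Dec_trans)

section \<open>Computably enumerable predicates\<close>

definition CE :: "nat set \<Rightarrow> (nat \<Rightarrow> bool) \<Rightarrow> bool" where
  "CE A P \<longleftrightarrow> (\<exists>Q. Dec A (\<lambda>z. Q (pi1 z) (pi2 z)) \<and> (\<forall>x. P x \<longleftrightarrow> (\<exists>y. Q x y)))"

lemma CE_ex:
  assumes "Dec A (\<lambda>z. Q (pi1 z) (pi2 z))" shows "CE A (\<lambda>x. \<exists>y. Q x y)"
  unfolding CE_def using assms by blast

lemma CE_comp:
  assumes "CE A P" "Rec A f" shows "CE A (\<lambda>x. P (f x))"
proof -
  obtain Q where Q: "Dec A (\<lambda>z. Q (pi1 z) (pi2 z))" "\<And>x. P x \<longleftrightarrow> (\<exists>y. Q x y)"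
    using assms(1) unfolding CE_def by blast
  have "Dec A (\<lambda>z. Q (f (pi1 z)) (pi2 z))"
    by (rule Dec_comp2[OF Q(1)]) (intro rec_intros Rec_comp[OF assms(2)])+
  then show ?thesis
    unfolding Q(2) by (rule CE_ex)
qed

lemma CE_Dec: "Dec A P \<Longrightarrow> CE A P"
  unfolding CE_def
  by (intro exI[of _ "\<lambda>x y. P x"] conjI) (simp_all add: Dec_comp Rec_pi1 Rec_id)

text \<open>The two existential witnesses are paired into one.\<close>

lemma CE_ex_CE:
  assumes "CE A (\<lambda>z. P (pi1 z) (pi2 z))" shows "CE A (\<lambda>x. \<exists>y. P x y)"
proof -
  obtain Q where Q: "Dec A (\<lambda>z. Q (pi1 z) (pi2 z))" "\<And>z. P (pi1 z) (pi2 z) \<longleftrightarrow> (\<exists>y. Q z y)"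
    using assms(1) unfolding CE_def by blast
  have "Dec A (\<lambda>z. Q (pr (pi1 z) (pi1 (pi2 z))) (pi2 (pi2 z)))"
    by (rule Dec_comp2[OF Q(1)]) (intro rec_intros)+
  then have "CE A (\<lambda>x. \<exists>w. Q (pr x (pi1 w)) (pi2 w))"
    by (rule CE_ex)
  moreover have "(\<exists>w. Q (pr x (pi1 w)) (pi2 w)) \<longleftrightarrow> (\<exists>y. P x y)" for x
    using Q(2) by (metis pi_pr)
  ultimately show ?thesis by simp
qed

lemma CE_conj:
  assumes "CE A P" "CE A Q" shows "CE A (\<lambda>x. P x \<and> Q x)"
proof -
  obtain P' where P: "Dec A (\<lambda>z. P' (pi1 z) (pi2 z))" "\<And>x. P x \<longleftrightarrow> (\<exists>y. P' x y)"
    using assms(1) unfolding CE_def by blast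
  obtain Q' where Q: "Dec A (\<lambda>z. Q' (pi1 z) (pi2 z))" "\<And>x. Q x \<longleftrightarrow> (\<exists>y. Q' x y)"
    using assms(2) unfolding CE_def by blast
  have "Dec A (\<lambda>z. P' (pi1 z) (pi1 (pi2 z)) \<and> Q' (pi1 z) (pi2 (pi2 z)))"
    by (rule Dec_conj; rule Dec_comp2[OF P(1)] Dec_comp2[OF Q(1)]; intro rec_intros)
  then have "CE A (\<lambda>x. \<exists>w. P' x (pi1 w) \<and> Q' x (pi2 w))"
    by (rule CE_ex)
  moreover have "(\<exists>w. P' x (pi1 w) \<and> Q' x (pi2 w)) \<longleftrightarrow> P x \<and> Q x" for x
    using P(2) Q(2) by (metis pi_pr)
  ultimately show ?thesis by simp
qed

text \<open>This is the instance of the parameter theorem that \<open>CE_jump\<close> needs: a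
  number can be built into a program effectively. The tag 6 belongs to \<open>CComp\<close>, and
  \<open>pr 1 0\<close> is the number of \<open>CSucc\<close>.\<close>

lemma Rec_code_number_const_code: "Rec A (\<lambda>x. code_number (const_code x))"
proof -
  have eq: "rec_nat (pr 0 0) (\<lambda>n r. pr 6 (pr (pr 1 0) r)) x = code_number (const_code x)" for x
    by (induction x) auto
  have "Rec A (\<lambda>x. rec_nat (pr 0 0) (\<lambda>n r. pr 6 (pr (pr 1 0) r)) x)"
    by (intro rec_intros)
  then show ?thesis
    by (simp only: eq)
qed

text \<open>The jump is queried at a program that ignores its input and searches for a witness of \<open>P x\<close>.\<close>

lemma CE_jump:
  assumes "CE A P" shows "Dec (jump A) P"
proof -
  obtain Q where Q: "Dec A (\<lambda>z. Q (pi1 z) (pi2 z))" "\<And>x. P x \<longleftrightarrow> (\<exists>y. Q x y)"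
    using assms(1) unfolding CE_def by blast
  have "Rec A (\<lambda>z. of_bool (\<not> Q (pi1 z) (pi2 z)))"
    using Q(1) by (intro rec_intros)
  then obtain c where "\<And>z. computes A c z (of_bool (\<not> Q (pi1 z) (pi2 z)))"
    unfolding Rec_def by blast
  then have c: "computes A c (pr x y) (of_bool (\<not> Q x y))" for x y
    by (metis pi_pr)
  define e where "e x = CComp (CMu c) (const_code x)" for x
  have "P x \<longleftrightarrow> code_number (e x) \<in> jump A" for x
  proof
    assume "P x"
    then have ex: "\<exists>y. Q x y" using Q(2) by blast
    with c have "computes A (CMu c) x (LEAST y. Q x y)"
      by (rule computes_CMu_Least)
    then have "computes A (e x) (code_number (e x)) (LEAST y. Q x y)"
      unfolding e_def using computes_const_code computes.comp by blast
    then show "code_number (e x) \<in> jump A"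
      unfolding jump_def Phi_def by blast
  next
    assume "code_number (e x) \<in> jump A"
    then obtain y where "computes A (e x) (code_number (e x)) y"
      unfolding jump_def Phi_def by (auto dest: injD[OF inj_code_number])
    then obtain z where z: "computes A (const_code x) (code_number (e x)) z" "computes A (CMu c) z y"
      unfolding e_def by cases blast
    have "z = x"
      using z(1) computes_const_code computes_deterministic by blast
    with z(2) have "computes A (CMu c) x y" by simp
    then have "computes A c (pr x y) 0"
      by cases
    then have "of_bool (\<not> Q x y) = (0 :: nat)"
      using c computes_deterministic by blast
    then show "P x"
      using Q(2) by auto
  qed
  then have "P = (\<lambda>x. pr 6 (pr (code_number (CMu c)) (code_number (const_code x))) \<in> jump A)"
    by (simp add: e_def fun_eq_iff)
  moreover have "Dec (jump A) (\<lambda>x. pr 6 (pr (code_number (CMu c)) (code_number (const_code x))) \<in> jump A)"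
    by (intro rec_intros Rec_code_number_const_code)
  ultimately show ?thesis
    by (simp only:)
qed

lemma turing_le_jump: "A \<le>\<^sub>T jump A"
  unfolding turing_le_iff_Dec by (intro CE_jump CE_Dec rec_intros)

text \<open>\<open>OK S t w\<close>: some rule with parameter \<open>w\<close> derives \<open>t\<close> from the finite set with canonical
  index \<open>S\<close>.\<close>

inductive derivable :: "(nat \<Rightarrow> nat \<Rightarrow> nat \<Rightarrow> bool) \<Rightarrow> nat \<Rightarrow> bool"
  for OK :: "nat \<Rightarrow> nat \<Rightarrow> nat \<Rightarrow> bool" where
  infer: "\<forall>u\<in>set_decode S. derivable OK u \<Longrightarrow> OK S t w \<Longrightarrow> derivable OK t"

lemma derivableI:
  "finite U \<Longrightarrow> (\<And>u. u \<in> U \<Longrightarrow> derivable OK u) \<Longrightarrow> OK (set_encode U) t w \<Longrightarrow> derivable OK t"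
  by (rule infer[of "set_encode U"]) auto

text \<open>Stage \<open>n\<close> of the enumeration tries the single rule instance coded by \<open>pi1 n\<close>; every instance
  is tried infinitely often, so it is tried after all its premises have been enumerated.\<close>

lemma CE_derivable:
  assumes dec: "Dec A (\<lambda>z. OK (pi1 z) (pi1 (pi2 z)) (pi2 (pi2 z)))"
    and mono: "\<And>S S' t w. OK S t w \<Longrightarrow> set_decode S \<subseteq> set_decode S' \<Longrightarrow> OK S' t w"
  shows "CE A (derivable OK)"
proof -
  define h where "h n S = (if OK S (pi1 (pi1 n)) (pi2 (pi1 n)) then ins (pi1 (pi1 n)) S else S)" for n S
  define st where "st = rec_nat 0 h"
  have st_Suc: "st (Suc n) = h n (st n)" for n
    by (simp add: st_def)
  have "Rec A (\<lambda>n. rec_nat 0 h n)"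
    unfolding h_def by (intro rec_intros Dec_comp3[OF dec])
  then have "Rec A st"
    by (simp add: st_def)
  then have "Dec A (\<lambda>z. pi1 z \<in> set_decode (st (pi2 z)))"
    by (intro rec_intros) (rule Rec_comp[OF _ Rec_pi2[OF Rec_id]])
  then have "CE A (\<lambda>t. \<exists>n. t \<in> set_decode (st n))"
    by (rule CE_ex)
  moreover have "(\<exists>n. t \<in> set_decode (st n)) \<longleftrightarrow> derivable OK t" for t
  proof
    have "\<forall>u\<in>set_decode (st n). derivable OK u" for n
    proof (induction n)
      case 0
      then show ?case by (simp add: st_def)
    next
      case (Suc n)
      then show ?case
        using infer[OF Suc] by (auto simp: st_Suc h_def)
    qed
    then show "\<exists>n. t \<in> set_decode (st n) \<Longrightarrow> derivable OK t" by blast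
  next
    have st_mono: "set_decode (st n) \<subseteq> set_decode (st m)" if "n \<le> m" for n m
      using that by (induction rule: dec_induct) (auto simp: st_Suc h_def)
    assume "derivable OK t"
    then show "\<exists>n. t \<in> set_decode (st n)"
    proof (induction rule: derivable.induct)
      case (infer S t w)
      have fin: "\<exists>n. U \<subseteq> set_decode (st n)" if "finite U" "U \<subseteq> set_decode S" for U
        using that
      proof (induction rule: finite_induct)
        case (insert u U)
        then obtain n where n: "U \<subseteq> set_decode (st n)" by blast
        from infer.IH insert.prems obtain m where m: "u \<in> set_decode (st m)" by blast
        have "insert u U \<subseteq> set_decode (st (max n m))"
          using n m st_mono[of n "max n m"] st_mono[of m "max n m"] by auto
        then show ?case ..
      qed simp
      then obtain n where n: "set_decode S \<subseteq> set_decode (st n)"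
        using fin[OF finite_set_decode order_refl] by blast
      define k where "k = pr (pr t w) n"
      have "n \<le> k"
        unfolding k_def by (rule le_prod_encode_2)
      then have "set_decode S \<subseteq> set_decode (st k)"
        using n st_mono by blast
      \<comment> \<open>By stage \<open>k\<close> more than the premises may have been enumerated;
        \<open>mono\<close> lets the rule fire from the larger set.\<close>
      with infer.hyps have "OK (st k) t w" by (rule_tac mono)
      then have "t \<in> set_decode (st (Suc k))"
        by (simp add: st_Suc h_def k_def)
      then show ?case ..
    qed
  qed
  ultimately show ?thesis by simp
qed

section \<open>Computations with partial oracles\<close>

text \<open>Only \<open>query\<close> really differs from \<open>computes\<close>: a query converges
  only where \<open>p\<close> supplies an answer, so a finite part of an oracle can drive a
  computation. The projections use \<open>pi1\<close> and \<open>pi2\<close> so that their rules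
  match any input.\<close>

inductive pcomp :: "(nat \<Rightarrow> nat \<Rightarrow> bool) \<Rightarrow> code \<Rightarrow> nat \<Rightarrow> nat \<Rightarrow> bool" for p where
  zero: "pcomp p CZero x 0"
| succ: "pcomp p CSucc x (Suc x)"
| fst: "pcomp p CFst x (pi1 x)"
| snd: "pcomp p CSnd x (pi2 x)"
| query: "p x y \<Longrightarrow> pcomp p COracle x y"
| pair: "pcomp p c x y \<Longrightarrow> pcomp p d x z \<Longrightarrow> pcomp p (CPair c d) x (pr y z)"
| comp: "pcomp p d x y \<Longrightarrow> pcomp p c y z \<Longrightarrow> pcomp p (CComp c d) x z"
| prec_0: "pcomp p c a y \<Longrightarrow> pcomp p (CPrec c d) (pr a 0) y"
| prec_Suc: "pcomp p (CPrec c d) (pr a n) y \<Longrightarrow> pcomp p d (pr a (pr n y)) z \<Longrightarrow>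
    pcomp p (CPrec c d) (pr a (Suc n)) z"
| mu: "pcomp p c (pr a n) 0 \<Longrightarrow> (\<forall>m<n. \<exists>k. pcomp p c (pr a m) (Suc k)) \<Longrightarrow> pcomp p (CMu c) a n"

lemma pcomp_mono:
  assumes "pcomp p c x y" "\<And>u v. p u v \<Longrightarrow> q u v" shows "pcomp q c x y"
  using assms(1)
proof (induction rule: pcomp.induct)
  case (mu c a n)
  then show ?case by (intro pcomp.mu) auto
qed (blast intro: pcomp.zero pcomp.succ pcomp.fst pcomp.snd pcomp.query assms(2)
  | (rule pcomp.pair pcomp.comp pcomp.prec_0 pcomp.prec_Suc; assumption))+

lemma pcomp_imp_computes:
  assumes "pcomp p c x y" "\<And>u v. p u v \<Longrightarrow> v = of_bool (u \<in> A)" shows "computes A c x y"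
  using assms(1)
proof (induction rule: pcomp.induct)
  case (fst x)
  then show ?case by (metis computes.fst pr_pi)
next
  case (snd x)
  then show ?case by (metis computes.snd pr_pi)
next
  case (query x y)
  then show ?case using assms(2)[OF query] computes.query[of A x] by (simp add: of_bool_def)
next
  case (mu c a n)
  then show ?case by (intro computes.mu) auto
qed (rule computes.zero computes.succ
  | (rule computes.pair computes.comp computes.prec_0 computes.prec_Suc; assumption))+

text \<open>The use principle: a convergent computation asks finitely many questions, and
  \<open>u\<close> bounds them.\<close>

lemma computes_imp_pcomp:
  assumes "computes A c x y"
  shows "\<exists>u. \<forall>p. (\<forall>z<u. p z (of_bool (z \<in> A))) \<longrightarrow> pcomp p c x y"
  using assms
proof (induction rule: computes.induct)
  case (zero x)
  show ?case by (intro exI allI impI pcomp.zero)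
next
  case (succ x)
  show ?case by (intro exI allI impI pcomp.succ)
next
  case (fst x y)
  show ?case using pcomp.fst[of _ "pr x y"] by simp
next
  case (snd x y)
  show ?case using pcomp.snd[of _ "pr x y"] by simp
next
  case (query x)
  show ?case
    by (intro exI[of _ "Suc x"] allI impI pcomp.query) (simp add: of_bool_def)
next
  case (pair c x y d z)
  then obtain u v where "\<forall>p. (\<forall>z<u. p z (of_bool (z \<in> A))) \<longrightarrow> pcomp p c x y"
    "\<forall>p. (\<forall>z<v. p z (of_bool (z \<in> A))) \<longrightarrow> pcomp p d x z" by blast
  then show ?case by (intro exI[of _ "max u v"] allI impI pcomp.pair) simp_all
next
  case (comp d x y c z)
  then obtain u v where "\<forall>p. (\<forall>z<u. p z (of_bool (z \<in> A))) \<longrightarrow> pcomp p d x y"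
    "\<forall>p. (\<forall>z<v. p z (of_bool (z \<in> A))) \<longrightarrow> pcomp p c y z" by blast
  then show ?case by (intro exI[of _ "max u v"] allI impI pcomp.comp[of _ d x y]) simp_all
next
  case (prec_0 c a y d)
  then show ?case by (blast intro: pcomp.prec_0)
next
  case (prec_Suc c d a n y z)
  then obtain u v where "\<forall>p. (\<forall>z<u. p z (of_bool (z \<in> A))) \<longrightarrow> pcomp p (CPrec c d) (pr a n) y"
    "\<forall>p. (\<forall>z<v. p z (of_bool (z \<in> A))) \<longrightarrow> pcomp p d (pr a (pr n y)) z" by blast
  then show ?case by (intro exI[of _ "max u v"] allI impI pcomp.prec_Suc[of _ c d a n y]) simp_all
next
  case (mu c a n)
  then obtain u where u: "\<forall>p. (\<forall>z<u. p z (of_bool (z \<in> A))) \<longrightarrow> pcomp p c (pr a n) 0" by blast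
  define Q where "Q m k v \<longleftrightarrow>
      (\<forall>p. (\<forall>z<v. p z (of_bool (z \<in> A))) \<longrightarrow> pcomp p c (pr a m) (Suc k))" for m k v
  have "\<forall>m<n. \<exists>k. computes A c (pr a m) (Suc k) \<and> (\<exists>v. Q m k v)"
    unfolding Q_def by (rule mu.IH(2))
  then obtain k v where kv: "\<And>m. m < n \<Longrightarrow> Q m (k m) (v m)"
    by metis
  have v: "\<forall>p. (\<forall>z<v m. p z (of_bool (z \<in> A))) \<longrightarrow> pcomp p c (pr a m) (Suc (k m))"
    if "m < n" for m
    by (rule kv[OF that, unfolded Q_def])
  \<comment> \<open>The search needs its final zero and the \<open>n\<close> positive values before
    it; \<open>w\<close> bounds the use of all of them.\<close>
  define w where "w = Max (insert u (v ` {..<n}))"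
  have w: "u \<le> w" "\<And>m. m < n \<Longrightarrow> v m \<le> w"
    by (auto simp: w_def)
  show ?case
  proof (rule exI[of _ w], intro allI impI, rule pcomp.mu)
    fix p :: "nat \<Rightarrow> nat \<Rightarrow> bool" assume p: "\<forall>z<w. p z (of_bool (z \<in> A))"
    show "pcomp p c (pr a n) 0"
      using p u w(1) by simp
    show "\<forall>m<n. \<exists>k. pcomp p c (pr a m) (Suc k)"
    proof (intro allI impI)
      fix m assume m: "m < n"
      have "\<forall>z<v m. p z (of_bool (z \<in> A))"
        using p w(2)[OF m] by simp
      then show "\<exists>k. pcomp p c (pr a m) (Suc k)"
        using v[OF m] by blast
    qed
  qed
qed

text \<open>A statement \<open>pr F (pr e (pr x y))\<close> says that the program numbered \<open>e\<close> yields \<open>y\<close> on \<open>x\<close>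
  with the partial oracle \<open>p F\<close>. The witness \<open>w\<close> is the intermediate value of a composition
  or recursion step.\<close>

definition run :: "nat \<Rightarrow> nat \<Rightarrow> nat \<Rightarrow> nat \<Rightarrow> nat" where
  "run F e x y = pr F (pr e (pr x y))"

lemma Rec_run [rec_intros]:
  "Rec A f \<Longrightarrow> Rec A e \<Longrightarrow> Rec A g \<Longrightarrow> Rec A h \<Longrightarrow> Rec A (\<lambda>z. run (f z) (e z) (g z) (h z))"
  unfolding run_def by (intro rec_intros)

text \<open>\<open>t\<close> and \<open>d\<close> are the two halves of a program number,
  \<open>t\<close> being the tag assigned by \<open>code_number\<close>. In the clause for
  \<open>CMu\<close> the value \<open>k\<close> stays below the index \<open>S\<close>, which keeps
  the rule decidable and loses nothing, since a derived statement exceeds neither \<open>S\<close>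
  nor falls below its own output.\<close>

definition run_step :: "(nat \<Rightarrow> nat \<Rightarrow> nat \<Rightarrow> bool) \<Rightarrow> nat set \<Rightarrow> nat \<Rightarrow> nat \<Rightarrow> nat \<Rightarrow> nat \<Rightarrow> nat \<Rightarrow> nat \<Rightarrow> nat \<Rightarrow> bool"
  where
  "run_step p D S F t d x y w \<longleftrightarrow>
     (t = 0 \<and> d = 0 \<and> y = 0) \<or>
     (t = 1 \<and> d = 0 \<and> y = Suc x) \<or>
     (t = 2 \<and> d = 0 \<and> y = pi1 x) \<or>
     (t = 3 \<and> d = 0 \<and> y = pi2 x) \<or>
     (t = 4 \<and> d = 0 \<and> p F x y) \<or>
     (t = 5 \<and> run F (pi1 d) x (pi1 y) \<in> D \<and> run F (pi2 d) x (pi2 y) \<in> D) \<or>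
     (t = 6 \<and> run F (pi2 d) x w \<in> D \<and> run F (pi1 d) w y \<in> D) \<or>
     (t = 7 \<and> pi2 x = 0 \<and> run F (pi1 d) (pi1 x) y \<in> D) \<or>
     (t = 7 \<and> 0 < pi2 x \<and> run F (pr 7 d) (pr (pi1 x) (pi2 x - 1)) w \<in> D \<and>
        run F (pi2 d) (pr (pi1 x) (pr (pi2 x - 1) w)) y \<in> D) \<or>
     (t = 8 \<and> run F d (pr x y) 0 \<in> D \<and> (\<forall>m<y. \<exists>k<S. run F d (pr x m) (Suc k) \<in> D))"

definition run_rule :: "(nat \<Rightarrow> nat \<Rightarrow> nat \<Rightarrow> bool) \<Rightarrow> nat \<Rightarrow> nat \<Rightarrow> nat \<Rightarrow> bool" where
  "run_rule p S u w = run_step p (set_decode S) S (pi1 u) (pi1 (pi1 (pi2 u))) (pi2 (pi1 (pi2 u)))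
     (pi1 (pi2 (pi2 u))) (pi2 (pi2 (pi2 u))) w"

lemma run_rule_run:
  "run_rule p S (run F (pr t d) x y) w = run_step p (set_decode S) S F t d x y w"
  by (simp add: run_rule_def run_def)

lemma set_decode_le: "set_decode S \<subseteq> set_decode S' \<Longrightarrow> S \<le> S'"
  by (metis finite_set_decode set_decode_inverse subset_decode_imp_le)

lemma CE_derivable_run:
  assumes p: "Dec A (\<lambda>z. p (pi1 z) (pi1 (pi2 z)) (pi2 (pi2 z)))"
  shows "CE A (derivable (run_rule p))"
proof (rule CE_derivable)
  show "Dec A (\<lambda>z. run_rule p (pi1 z) (pi1 (pi2 z)) (pi2 (pi2 z)))"
    unfolding run_rule_def run_step_def by (intro rec_intros Dec_comp3[OF p])
next
  fix S S' u w assume *: "run_rule p S u w" "set_decode S \<subseteq> set_decode S'"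
  \<comment> \<open>The bound on \<open>k\<close> in the clause for \<open>CMu\<close> has to grow
    along with the set.\<close>
  then have "S \<le> S'" by (simp add: set_decode_le)
  with * show "run_rule p S' u w"
    unfolding run_rule_def run_step_def
    by (elim disjE) (simp_all add: subset_iff, (meson order_less_le_trans)+)
qed

text \<open>Restricting to numbers of programs suits the induction: the premises then concern the
  same program or its immediate subprograms.\<close>

lemma derivable_run_imp_pcomp:
  assumes "derivable (run_rule p) u" "u = run F (code_number c) x y"
  shows "pcomp (p F) c x y"
  using assms
proof (induction u arbitrary: c x y rule: derivable.induct)
  case (infer S u w)
  let ?D = "set_decode S"
  have IH: "pcomp (p F) c' x' y'" if "run F (code_number c') x' y' \<in> ?D" for c' x' y'
    using infer.IH that by blast
  have step: "run_rule p S (run F (code_number c) x y) w"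
    using infer.hyps infer.prems by simp
  show ?case
  proof (cases c)
    case CZero
    with step show ?thesis by (simp add: run_rule_run run_step_def pcomp.zero)
  next
    case CSucc
    with step show ?thesis by (simp add: run_rule_run run_step_def pcomp.succ)
  next
    case CFst
    with step show ?thesis by (simp add: run_rule_run run_step_def pcomp.fst)
  next
    case CSnd
    with step show ?thesis by (simp add: run_rule_run run_step_def pcomp.snd)
  next
    case COracle
    with step show ?thesis by (simp add: run_rule_run run_step_def pcomp.query)
  next
    case (CPair c1 c2)
    with step have "pcomp (p F) c1 x (pi1 y)" "pcomp (p F) c2 x (pi2 y)"
      by (simp_all add: run_rule_run run_step_def IH)
    then show ?thesis
      using pcomp.pair CPair by fastforce
  next
    case (CComp c1 c2)
    with step have "pcomp (p F) c2 x w" "pcomp (p F) c1 w y"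
      by (simp_all add: run_rule_run run_step_def IH)
    then show ?thesis
      using CComp by (auto intro: pcomp.comp)
  next
    case (CPrec c1 c2)
    show ?thesis
    proof (cases "pi2 x")
      case 0
      with step CPrec have "pcomp (p F) c1 (pi1 x) y"
        by (simp add: run_rule_run run_step_def IH)
      from pcomp.prec_0[OF this, of c2] show ?thesis
        using CPrec 0 by (metis pr_pi)
    next
      case (Suc n)
      with step CPrec have "run F (code_number (CPrec c1 c2)) (pr (pi1 x) n) w \<in> ?D"
        "pcomp (p F) c2 (pr (pi1 x) (pr n w)) y"
        by (simp_all add: run_rule_run run_step_def IH)
      from pcomp.prec_Suc[OF IH[OF this(1)] this(2)] show ?thesis
        using CPrec Suc by (metis pr_pi)
    qed
  next
    case (CMu c')
    with step have "pcomp (p F) c' (pr x y) 0"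
      "\<forall>m<y. \<exists>k. run F (code_number c') (pr x m) (Suc k) \<in> ?D"
      by (auto simp: run_rule_run run_step_def IH)
    then show ?thesis
      unfolding CMu by (intro pcomp.mu) (auto intro: IH)
  qed
qed

lemma set_decode_power2 [simp]: "set_decode (2 ^ x) = {x}"
  using set_encode_inverse[of "{x}"] by simp

lemma le_run: "y \<le> run F e x y"
  unfolding run_def by (meson le_prod_encode_2 order_trans)

lemma pcomp_imp_derivable_run:
  assumes "pcomp (p F) c x y"
  shows "derivable (run_rule p) (run F (code_number c) x y)"
  using assms
proof (induction rule: pcomp.induct)
  case (pair c x y d z)
  show ?case
    by (rule derivableI[of "{run F (code_number c) x y, run F (code_number d) x z}"])
        (use pair.IH in \<open>auto simp: run_rule_run run_step_def\<close>)
next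
  case (comp d x y c z)
  show ?case
    by (rule derivableI[of "{run F (code_number d) x y, run F (code_number c) y z}" _ _ y])
        (use comp.IH in \<open>auto simp: run_rule_run run_step_def\<close>)
next
  case (prec_0 c a y d)
  show ?case
    by (rule derivableI[of "{run F (code_number c) a y}"])
        (use prec_0.IH in \<open>auto simp: run_rule_run run_step_def\<close>)
next
  case (prec_Suc c d a n y z)
  show ?case
    by (rule derivableI[of "{run F (code_number (CPrec c d)) (pr a n) y,
        run F (code_number d) (pr a (pr n y)) z}" _ _ y])
        (use prec_Suc.IH in \<open>auto simp: run_rule_run run_step_def\<close>)
next
  case (mu c a n)
  then obtain k where
    k: "\<And>m. m < n \<Longrightarrow> derivable (run_rule p) (run F (code_number c) (pr a m) (Suc (k m)))"
    by metis
  define U where "U = insert (run F (code_number c) (pr a n) 0)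
      ((\<lambda>m. run F (code_number c) (pr a m) (Suc (k m))) ` {..<n})"
  have U: "finite U" "run F (code_number c) (pr a n) 0 \<in> U"
    "\<And>m. m < n \<Longrightarrow> run F (code_number c) (pr a m) (Suc (k m)) \<in> U"
    by (auto simp: U_def)
  \<comment> \<open>The output \<open>Suc (k m)\<close> is a component of a statement in
    \<open>U\<close>, and every member of \<open>U\<close> lies below the index of
    \<open>U\<close>.\<close>
  have "k m < set_encode U" if "m < n" for m
  proof -
    have "run F (code_number c) (pr a m) (Suc (k m)) < set_encode U"
      using U(1) U(3)[OF that] by (intro set_decode_less) simp
    with le_run[of "Suc (k m)"] show ?thesis
      by (meson Suc_le_lessD order_less_trans)
  qed
  with U have "\<forall>m<n. \<exists>l<set_encode U. run F (code_number c) (pr a m) (Suc l) \<in> U"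
    by blast
  with U have "run_rule p (set_encode U) (run F (code_number (CMu c)) a n) 0"
    by (simp add: run_rule_run run_step_def)
  moreover have "derivable (run_rule p) u" if "u \<in> U" for u
    using that mu.IH(1) k by (auto simp: U_def)
  ultimately show ?case
    using U(1) by (rule_tac derivableI)
qed (rule derivableI[of "{}"]; simp add: run_rule_run run_step_def)+

text \<open>Numbers of programs have to be recognized separately, because the rules for runs also
  accept others: a recursion evaluated at 0 never inspects its second component. Tags below 5 have
  no subprograms, tags 5 to 7 have two, tag 8 has one.\<close>

definition code_rule :: "nat \<Rightarrow> nat \<Rightarrow> nat \<Rightarrow> bool" where
  "code_rule S e w \<longleftrightarrow>
     pi1 e < 5 \<and> pi2 e = 0 \<or>
     5 \<le> pi1 e \<and> pi1 e < 8 \<and> pi1 (pi2 e) \<in> set_decode S \<and> pi2 (pi2 e) \<in> set_decode S \<or>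
     pi1 e = 8 \<and> pi2 e \<in> set_decode S"

lemma derivable_code_rule: "derivable code_rule e \<longleftrightarrow> e \<in> range code_number"
proof
  assume "derivable code_rule e"
  then show "e \<in> range code_number"
  proof (induction rule: derivable.induct)
    case (infer S e w)
    then have IH: "\<exists>c. u = code_number c" if "u \<in> set_decode S" for u
      using that by blast
    from infer.hyps consider "pi1 e < 5" "pi2 e = 0"
      | "5 \<le> pi1 e" "pi1 e < 8" "pi1 (pi2 e) \<in> set_decode S" "pi2 (pi2 e) \<in> set_decode S"
      | "pi1 e = 8" "pi2 e \<in> set_decode S"
      unfolding code_rule_def by metis
    then show ?case
    proof cases
      case 1
      then have "pi1 e \<in> {0, 1, 2, 3, 4}" by auto
      then have "e \<in> {pr 0 0, pr 1 0, pr 2 0, pr 3 0, pr 4 0}"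
        using 1(2) pr_pi[of e] by fastforce
      then show ?thesis
        using rangeI[of code_number CZero] rangeI[of code_number CSucc] rangeI[of code_number CFst]
          rangeI[of code_number CSnd] rangeI[of code_number COracle] by auto
    next
      case 2
      then obtain c d where "pi2 e = pr (code_number c) (code_number d)"
        using IH pr_pi[of "pi2 e"] by metis
      moreover have "pi1 e \<in> {5, 6, 7}" using 2 by auto
      ultimately have "e \<in> {code_number (CPair c d), code_number (CComp c d), code_number (CPrec c d)}"
        using pr_pi[of e] by (metis code_number.simps(6-8) insert_iff empty_iff)
      then show ?thesis by blast
    next
      case 3
      then obtain c where "e = code_number (CMu c)"
        using IH pr_pi[of e] by (metis code_number.simps(9))
      then show ?thesis by blast
    qed
  qed
next
  have "derivable code_rule (code_number c)" for c
  proof (induction c)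
    case (CPair c d)
    show ?case
      by (rule derivableI[of "{code_number c, code_number d}"])
        (use CPair.IH in \<open>auto simp: code_rule_def\<close>)
  next
    case (CComp c d)
    show ?case
      by (rule derivableI[of "{code_number c, code_number d}"])
        (use CComp.IH in \<open>auto simp: code_rule_def\<close>)
  next
    case (CPrec c d)
    show ?case
      by (rule derivableI[of "{code_number c, code_number d}"])
        (use CPrec.IH in \<open>auto simp: code_rule_def\<close>)
  next
    case (CMu c)
    show ?case
      by (rule derivableI[of "{code_number c}"])
        (use CMu.IH in \<open>auto simp: code_rule_def\<close>)
  qed (rule derivableI[of "{}"]; simp add: code_rule_def)+
  then show "e \<in> range code_number \<Longrightarrow> derivable code_rule e" by blast
qed

section \<open>Enumerating halting computations and comparing jumps\<close>

lemma CE_range_code_number: "CE A (\<lambda>e. e \<in> range code_number)"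
proof -
  have "CE A (derivable code_rule)"
  proof (rule CE_derivable)
    show "Dec A (\<lambda>z. code_rule (pi1 z) (pi1 (pi2 z)) (pi2 (pi2 z)))"
      unfolding code_rule_def by (intro rec_intros)
  qed (auto simp: code_rule_def)
  then show ?thesis
    unfolding derivable_code_rule[abs_def, symmetric] by simp
qed

text \<open>The oracle depends on the parameter \<open>pi2 z\<close>, so one enumeration serves all
  finite conditions. As in the jump, the program runs on its own number.\<close>

lemma CE_halts:
  assumes "Dec A (\<lambda>z. p (pi1 z) (pi1 (pi2 z)) (pi2 (pi2 z)))"
  shows "CE A (\<lambda>z. \<exists>c y. code_number c = pi1 z \<and> pcomp (p (pi2 z)) c (pi1 z) y)"
proof -
  have "CE A (\<lambda>z. derivable (run_rule p) (run (pi2 (pi1 z)) (pi1 (pi1 z)) (pi1 (pi1 z)) (pi2 z)))"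
    by (rule CE_comp[OF CE_derivable_run[OF assms]]) (intro rec_intros)
  then have "CE A (\<lambda>z. \<exists>y. derivable (run_rule p) (run (pi2 z) (pi1 z) (pi1 z) y))"
    by (rule CE_ex_CE)
  moreover have "CE A (\<lambda>z. pi1 z \<in> range code_number)"
    by (rule CE_comp[OF CE_range_code_number]) (intro rec_intros)
  ultimately have "CE A (\<lambda>z. pi1 z \<in> range code_number \<and>
      (\<exists>y. derivable (run_rule p) (run (pi2 z) (pi1 z) (pi1 z) y)))"
    by (rule CE_conj[rotated])
  moreover have "pi1 z \<in> range code_number \<and> (\<exists>y. derivable (run_rule p) (run (pi2 z) (pi1 z) (pi1 z) y))
      \<longleftrightarrow> (\<exists>c y. code_number c = pi1 z \<and> pcomp (p (pi2 z)) c (pi1 z) y)" for z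
    using derivable_run_imp_pcomp pcomp_imp_derivable_run by (metis rangeE rangeI)
  ultimately show ?thesis by simp
qed

text \<open>The partial oracle is instantiated with the total oracle \<open>A\<close>, independent
  of the parameter, which is set to 0.\<close>

lemma CE_jump_self: "CE A (\<lambda>e. e \<in> jump A)"
proof -
  let ?p = "\<lambda>F z b. b = (of_bool (z \<in> A) :: nat)"
  have "CE A (\<lambda>z. \<exists>c y. code_number c = pi1 z \<and> pcomp (?p (pi2 z)) c (pi1 z) y)"
    by (rule CE_halts) (intro rec_intros)
  from CE_comp[OF this, of "\<lambda>e. pr e 0"]
  have "CE A (\<lambda>e. \<exists>c y. code_number c = e \<and> pcomp (?p 0) c e y)"
    by (simp add: Rec_pr Rec_id Rec_const)
  moreover have "pcomp (?p 0) c x y \<longleftrightarrow> computes A c x y" for c x y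
  proof
    show "pcomp (?p 0) c x y \<Longrightarrow> computes A c x y"
      by (rule pcomp_imp_computes)
    assume "computes A c x y"
    then obtain u where "\<forall>p. (\<forall>z<u. p z (of_bool (z \<in> A))) \<longrightarrow> pcomp p c x y"
      using computes_imp_pcomp by blast
    then show "pcomp (?p 0) c x y" by simp
  qed
  moreover have "e \<in> jump A \<longleftrightarrow> (\<exists>c y. code_number c = e \<and> computes A c e y)" for e
    unfolding jump_def Phi_def by blast
  ultimately show ?thesis
    by simp
qed

text \<open>The decidable matrix that enumerates \<open>jump B\<close> from \<open>B\<close> is
  decidable in \<open>A\<close> as well, so \<open>jump B\<close> is enumerable in
  \<open>A\<close>.\<close>

lemma jump_mono:
  assumes "B \<le>\<^sub>T A" shows "jump B \<le>\<^sub>T jump A"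
proof -
  obtain Q where Q: "Dec B (\<lambda>z. Q (pi1 z) (pi2 z))" "\<And>e. e \<in> jump B \<longleftrightarrow> (\<exists>y. Q e y)"
    using CE_jump_self[of B] unfolding CE_def by blast
  have "CE A (\<lambda>e. e \<in> jump B)"
    unfolding Q(2) by (rule CE_ex[OF Dec_trans[OF Q(1) assms]])
  then show ?thesis
    unfolding turing_le_iff_Dec by (rule CE_jump)
qed

lemma low_downward: "low A \<Longrightarrow> B \<le>\<^sub>T A \<Longrightarrow> low B"
  unfolding low_def using jump_mono turing_le_trans by blast

section \<open>Bushy forcing with finite rainbows\<close>

definition endext :: "nat set \<Rightarrow> nat set \<Rightarrow> bool" where
  "endext F G \<longleftrightarrow> F \<subseteq> G \<and> (\<forall>x\<in>G - F. \<forall>y\<in>F. y < x)"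

lemma endext_refl [simp]: "endext F F"
  by (simp add: endext_def)

lemma endext_trans: "endext F G \<Longrightarrow> endext G H \<Longrightarrow> endext F H"
  unfolding endext_def by blast

lemma endext_insert: "(\<forall>y\<in>F. y < x) \<Longrightarrow> endext F (insert x F)"
  by (auto simp: endext_def)

text \<open>The part of the oracle \<open>join X R\<close> that is determined by an initial segment \<open>F\<close> of \<open>R\<close>.\<close>

definition part :: "nat set \<Rightarrow> nat set \<Rightarrow> nat \<Rightarrow> nat \<Rightarrow> bool" where
  "part X F z b \<longleftrightarrow> (even z \<or> (\<exists>y\<in>F. z div 2 \<le> y)) \<and> b = of_bool (z \<in> join X F)"

lemma in_join_iff: "z \<in> join A B \<longleftrightarrow> (if even z then z div 2 \<in> A else z div 2 \<in> B)"
proof (cases "even z")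
  case True
  then show ?thesis unfolding join_def by auto
next
  case False
  then show ?thesis unfolding join_def by (auto elim!: oddE; presburger)
qed

text \<open>Odd queries are answered only up to an element of \<open>F\<close>, and an end extension
  adds points only above all of \<open>F\<close>, so it preserves those answers.\<close>

lemma part_mono: "endext F G \<Longrightarrow> part X F z b \<Longrightarrow> part X G z b"
proof -
  assume ext: "endext F G" and p: "part X F z b"
  have "z div 2 \<in> F \<longleftrightarrow> z div 2 \<in> G" if "y \<in> F" "z div 2 \<le> y" for y
    using ext that unfolding endext_def by (metis DiffI not_le subsetD)
  with p ext show "part X G z b"
    unfolding part_def in_join_iff endext_def by auto
qed

definition halts :: "nat set \<Rightarrow> nat \<Rightarrow> nat set \<Rightarrow> bool" where
  "halts X e F \<longleftrightarrow> (\<exists>c y. code_number c = e \<and> pcomp (part X F) c e y)"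

lemma halts_mono: "endext F G \<Longrightarrow> halts X e F \<Longrightarrow> halts X e G"
  unfolding halts_def using pcomp_mono[of "part X F" _ _ _ "part X G"] part_mono[of F G X] by blast

lemma halts_imp_jump:
  assumes "endext F R" "halts X e F" shows "e \<in> jump (join X R)"
proof -
  obtain c y where c: "code_number c = e" "pcomp (part X F) c e y"
    using assms(2) unfolding halts_def by blast
  have "computes (join X R) c e y"
  proof (rule pcomp_imp_computes[OF c(2)])
    fix u v assume "part X F u v"
    from part_mono[OF assms(1) this] show "v = of_bool (u \<in> join X R)"
      by (simp add: part_def)
  qed
  then show ?thesis
    unfolding jump_def Phi_def using c(1) by blast
qed

text \<open>Once \<open>F\<close> reaches the use bound \<open>u\<close>, it answers every query
  below \<open>u\<close> in the same way as the full oracle.\<close>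

lemma jump_imp_halts:
  assumes "e \<in> jump (join X R)"
  shows "\<exists>u. \<forall>F. endext F R \<longrightarrow> (\<exists>y\<in>F. u \<le> y) \<longrightarrow> halts X e F"
proof -
  obtain c y where c: "code_number c = e" "computes (join X R) c e y"
    using assms unfolding jump_def Phi_def by blast
  from computes_imp_pcomp[OF c(2)]
  obtain u where u: "\<forall>p. (\<forall>z<u. p z (of_bool (z \<in> join X R))) \<longrightarrow> pcomp p c e y" ..
  have "halts X e F" if F: "endext F R" "y' \<in> F" "u \<le> y'" for F y'
  proof -
    have "part X F z (of_bool (z \<in> join X R))" if "z < u" for z
    proof -
      have "z div 2 \<le> y'" using that F(3) by linarith
      then have "part X F z (of_bool (z \<in> join X F))"
        using F(2) by (auto simp: part_def)
      with part_mono[OF F(1) this] show ?thesis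
        by (simp add: part_def)
    qed
    then have "pcomp (part X F) c e y" using spec[OF u, of "part X F"] by blast
    then show ?thesis unfolding halts_def using c(1) by blast
  qed
  then show ?thesis by blast
qed

section \<open>Good rainbows and their one-point extensions\<close>

locale stable_coloring =
  fixes X :: "nat set" and f :: "nat \<Rightarrow> nat \<Rightarrow> nat"
  assumes Rec_f: "Rec X (\<lambda>z. f (pi1 z) (pi2 z))"
    and bounded: "two_bounded f"
    and stable: "weakly_rainbow_stable f"
begin

definition sim :: "nat \<Rightarrow> nat \<Rightarrow> bool" where
  "sim x y \<longleftrightarrow> (\<exists>s0. \<forall>s>s0. f x s = f y s)"

lemma sim_sym: "sim x y \<Longrightarrow> sim y x"
  unfolding sim_def by metis

text \<open>Stability speaks only about \<open>s\<close> above both points, so the threshold is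
  taken past them too.\<close>

lemma stable_cases: "\<exists>s0. (\<forall>s>s0. f x s = f y s) \<or> (\<forall>s>s0. f x s \<noteq> f y s)"
proof -
  have *: "\<exists>s0. \<forall>s>s0. P s" if "finite {s. x < s \<and> y < s \<and> \<not> P s}" for P
  proof -
    from that obtain b where "\<forall>s\<in>{s. x < s \<and> y < s \<and> \<not> P s}. s \<le> b"
      using finite_nat_set_iff_bounded_le by blast
    then have "\<forall>s>max b (max x y). P s" by fastforce
    then show ?thesis ..
  qed
  from stable have "finite {s. x < s \<and> y < s \<and> f x s \<noteq> f y s} \<or> finite {s. x < s \<and> y < s \<and> f x s = f y s}"
    unfolding weakly_rainbow_stable_def by blast
  then show ?thesis
    using *[of "\<lambda>s. f x s = f y s"] *[of "\<lambda>s. f x s \<noteq> f y s"] by auto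
qed

lemma finite_color: "finite {s. y < s \<and> f y s = c}"
proof -
  have "finite {(x, s) \<in> pairs UNIV. f x s = c}"
    using bounded unfolding two_bounded_def by blast
  then have "finite (snd ` {(x, s) \<in> pairs UNIV. f x s = c})" by simp
  moreover have "{s. y < s \<and> f y s = c} \<subseteq> snd ` {(x, s) \<in> pairs UNIV. f x s = c}"
    by (force simp: pairs_def)
  ultimately show ?thesis by (rule rev_finite_subset)
qed

text \<open>Three distinct points that eventually agree in color would give three pairs of one color
  at a common large \<open>s\<close>, against 2-boundedness.\<close>

lemma sim_unique:
  assumes "sim x z" "sim y z" "x \<noteq> z" "y \<noteq> z" shows "x = y"
proof (rule ccontr)
  assume "x \<noteq> y"
  obtain a b where ab: "\<forall>s>a. f x s = f z s" "\<forall>s>b. f y s = f z s"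
    using assms(1,2) unfolding sim_def by blast
  define s where "s = Suc (a + b + x + y + z)"
  have "f x s = f z s" "f y s = f z s"
    using ab by (simp_all add: s_def)
  moreover have "x < s" "y < s" "z < s" by (simp_all add: s_def)
  ultimately have sub: "{(x, s), (y, s), (z, s)} \<subseteq> {(u, v) \<in> pairs UNIV. f u v = f z s}"
    by (simp add: pairs_def)
  have fin: "finite {(u, v) \<in> pairs UNIV. f u v = f z s}"
    "card {(u, v) \<in> pairs UNIV. f u v = f z s} \<le> 2"
    using bounded unfolding two_bounded_def by blast+
  from card_mono[OF fin(1) sub] fin(2) have "card {(x, s), (y, s), (z, s)} \<le> 2"
    by (rule order_trans)
  with \<open>x \<noteq> y\<close> assms(3,4) show False by simp
qed

definition good :: "nat set \<Rightarrow> bool" where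
  "good F \<longleftrightarrow> rainbow f F \<and> (\<forall>x\<in>F. \<forall>y\<in>F. x \<noteq> y \<longrightarrow> \<not> sim x y)"

definition child :: "nat set \<Rightarrow> nat \<Rightarrow> bool" where
  "child F x \<longleftrightarrow> (\<forall>y\<in>F. y < x) \<and> rainbow f (insert x F)"

text \<open>A child fails to be good only by being similar to some \<open>y\<close> in
  \<open>F\<close>, and each \<open>y\<close> has at most one partner by
  \<open>sim_unique\<close>.\<close>

lemma bad_children:
  assumes "finite F" "good F"
  shows "finite {x. child F x \<and> \<not> good (insert x F)}"
    and "card {x. child F x \<and> \<not> good (insert x F)} \<le> card F"
proof -
  let ?P = "\<lambda>y. {x. x \<noteq> y \<and> sim x y}"
  have P: "finite (?P y) \<and> card (?P y) \<le> 1" for y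
  proof (cases "?P y = {}")
    case True
    then show ?thesis by (simp only: finite.emptyI card.empty) simp
  next
    case False
    then obtain x where "x \<in> ?P y" by blast
    then have "?P y \<subseteq> {x}" using sim_unique[of _ y x] by auto
    then show ?thesis
      using card_mono[of "{x}" "?P y"] finite_subset[of "?P y" "{x}"] by simp
  qed
  have sub: "{x. child F x \<and> \<not> good (insert x F)} \<subseteq> (\<Union>y\<in>F. ?P y)"
  proof
    fix x assume "x \<in> {x. child F x \<and> \<not> good (insert x F)}"
    then have "\<forall>y\<in>F. y < x" "\<exists>u\<in>insert x F. \<exists>v\<in>insert x F. u \<noteq> v \<and> sim u v"
      unfolding good_def child_def by auto
    then obtain y where "y \<in> F" "x \<noteq> y" "sim x y"
      using assms(2) sim_sym unfolding good_def by blast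
    then show "x \<in> (\<Union>y\<in>F. ?P y)" by blast
  qed
  have fin: "finite (\<Union>y\<in>F. ?P y)"
    using assms(1) P by blast
  show "finite {x. child F x \<and> \<not> good (insert x F)}"
    using sub fin by (rule finite_subset)
  have "card {x. child F x \<and> \<not> good (insert x F)} \<le> card (\<Union>y\<in>F. ?P y)"
    using fin sub by (rule card_mono)
  also have "\<dots> \<le> (\<Sum>y\<in>F. card (?P y))"
    using assms(1) by (rule card_UN_le)
  also have "\<dots> \<le> (\<Sum>y\<in>F. 1)"
    by (rule sum_mono) (use P in blast)
  finally show "card {x. child F x \<and> \<not> good (insert x F)} \<le> card F" by simp
qed

lemma rainbow_iff:
  "rainbow f F \<longleftrightarrow> (\<forall>x\<in>F. \<forall>s\<in>F. \<forall>x'\<in>F. \<forall>s'\<in>F.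
     x < s \<and> x' < s' \<and> f x s = f x' s' \<longrightarrow> x = x' \<and> s = s')"
  unfolding rainbow_def inj_on_def pairs_def by auto

lemma infinite_children:
  assumes "finite F" "good F" shows "infinite {x. child F x}"
proof -
  \<comment> \<open>Three finite obstacles to being a child: \<open>E1\<close> not lying above
    \<open>F\<close>, \<open>E2\<close> repeating a color attained on \<open>F\<close>, and
    \<open>E3\<close> giving two new pairs the same color. Goodness and stability make
    \<open>E3\<close> finite, 2-boundedness makes \<open>E2\<close> finite.\<close>
  define E1 where "E1 = (\<Union>y\<in>F. {..y})"
  define E2 where "E2 = (\<Union>y\<in>F. \<Union>a\<in>F. \<Union>b\<in>F. {x. y < x \<and> f y x = f a b})"
  define E3 where "E3 = (\<Union>y\<in>F. \<Union>y'\<in>F. if y = y' then {} else {x. y < x \<and> y' < x \<and> f y x = f y' x})"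
  have "finite {x. y < x \<and> y' < x \<and> f y x = f y' x}" if "y \<in> F" "y' \<in> F" "y \<noteq> y'" for y y'
  proof -
    have "\<not> sim y y'" using assms(2) that unfolding good_def by blast
    then obtain s0 where "\<forall>s>s0. f y s \<noteq> f y' s"
      using stable_cases[of y y'] unfolding sim_def by blast
    then have "{x. y < x \<and> y' < x \<and> f y x = f y' x} \<subseteq> {..s0}" by (auto simp: not_less[symmetric])
    then show ?thesis by (rule finite_subset) simp
  qed
  then have "finite E3" using assms(1) by (auto simp: E3_def)
  moreover have "finite E2" unfolding E2_def using assms(1) finite_color by blast
  moreover have "finite E1" unfolding E1_def using assms(1) by blast
  ultimately have fin: "finite (E1 \<union> E2 \<union> E3)" by blast
  have "child F x" if x: "x \<notin> E1 \<union> E2 \<union> E3" for x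
  proof -
    from x have x1: "x \<notin> E1" and x2: "x \<notin> E2" and x3: "x \<notin> E3"
      by blast+
    have lt: "y < x" if "y \<in> F" for y
      using x1 that by (auto simp: E1_def not_le)
    have e2: "f y x \<noteq> f a b" if "y \<in> F" "a \<in> F" "b \<in> F" for y a b
    proof
      assume "f y x = f a b"
      with that lt[OF that(1)] have "x \<in> E2" unfolding E2_def by blast
      with x2 show False ..
    qed
    have e3: "f y x \<noteq> f y' x" if "y \<in> F" "y' \<in> F" "y \<noteq> y'" for y y'
    proof -
      have "x \<notin> (if y = y' then {} else {x. y < x \<and> y' < x \<and> f y x = f y' x})"
        using x3 that unfolding E3_def by blast
      then show ?thesis using that lt by simp
    qed
    have rb: "a = a' \<and> s = s'" if "a \<in> F" "s \<in> F" "a' \<in> F" "s' \<in> F" "a < s" "a' < s'" "f a s = f a' s'"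
      for a s a' s'
      using assms(2) that unfolding good_def rainbow_iff by blast
    have "rainbow f (insert x F)"
      unfolding rainbow_iff
    proof (intro ballI impI)
      fix a s a' s'
      assume m: "a \<in> insert x F" "s \<in> insert x F" "a' \<in> insert x F" "s' \<in> insert x F"
        and h: "a < s \<and> a' < s' \<and> f a s = f a' s'"
      have aF: "a \<in> F" "a' \<in> F"
        using m h lt by (auto dest: less_asym)
      show "a = a' \<and> s = s'"
      proof (cases "s = x"; cases "s' = x")
        assume "s = x" "s' = x"
        then show ?thesis using h e3[OF aF] by auto
      next
        assume "s = x" "s' \<noteq> x"
        then show ?thesis using m h e2[OF aF, of s'] by auto
      next
        assume "s \<noteq> x" "s' = x"
        then show ?thesis using m h e2[OF aF(2,1), of s] by auto
      next
        assume "s \<noteq> x" "s' \<noteq> x"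
        then show ?thesis using m h rb[OF aF(1) _ aF(2)] by blast
      qed
    qed
    then show ?thesis unfolding child_def using lt by blast
  qed
  then have "- {x. child F x} \<subseteq> E1 \<union> E2 \<union> E3" by blast
  then have "finite (- {x. child F x})"
    using fin by (rule finite_subset)
  then show ?thesis
    using finite_Un[of "{x. child F x}" "- {x. child F x}"] infinite_UNIV_nat by (simp add: Compl_partition)
qed

text \<open>A derivation of \<open>Big m I F\<close> is a finite tree of rainbows. At most \<open>card F\<close> of the children of a
  good \<open>F\<close> are not good, so the branching factor \<open>m * (card F + 1)\<close> leaves room to avoid them.\<close>

inductive Big :: "nat \<Rightarrow> nat set \<Rightarrow> nat set \<Rightarrow> bool" for m I where
  leaf: "i \<in> I \<Longrightarrow> halts X i F \<Longrightarrow> Big m I F"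
| node: "finite W \<Longrightarrow> m * Suc (card F) \<le> card W \<Longrightarrow>
    (\<forall>x\<in>W. child F x \<and> Big m I (insert x F)) \<Longrightarrow> Big m I F"

lemma Big_mono: "Big m I F \<Longrightarrow> m' \<le> m \<Longrightarrow> Big m' I F"
proof (induction rule: Big.induct)
  case (leaf i F)
  then show ?case by (intro Big.leaf)
next
  case (node W F)
  have "m' * Suc (card F) \<le> m * Suc (card F)"
    using node.prems by (rule mult_le_mono1)
  with node show ?case
    by (intro Big.node[of W]) auto
qed

text \<open>Without leaves, a tree can end only in nodes that have no children, and the branching
  bound then forces \<open>m = 0\<close>.\<close>

lemma not_Big_empty: "Big m {} F \<Longrightarrow> m = 0"
proof (induction rule: Big.induct)
  case (node W F)
  then show ?case by (cases "W = {}") auto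
qed simp

lemma card_Big_children:
  assumes "\<not> Big m I F" "finite W" "\<forall>x\<in>W. child F x \<and> Big m I (insert x F)"
  shows "card W < m * Suc (card F)"
  using assms Big.node not_le by blast

text \<open>Pigeonhole at every node: the children split into those big for \<open>I\<close> and
  those big for \<open>J\<close>, and one of the two families reaches its share of the
  branching.\<close>

lemma Big_union: "Big (m + n) (I \<union> J) F \<Longrightarrow> Big m I F \<or> Big n J F"
proof (induction rule: Big.induct)
  case (leaf i F)
  then show ?case by (auto intro: Big.leaf)
next
  case (node W F)
  let ?U = "{x \<in> W. Big m I (insert x F)}" and ?V = "{x \<in> W. Big n J (insert x F)}"
  show ?case
  proof (rule ccontr)
    assume "\<not> ?thesis"
    then have "\<not> Big m I F" "\<not> Big n J F" by blast+
    then have "card ?U < m * Suc (card F)" "card ?V < n * Suc (card F)"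
      using node by (blast intro: card_Big_children finite_subset[of _ W])+
    moreover have "card W \<le> card ?U + card ?V"
    proof -
      have "W = ?U \<union> ?V" using node.IH by blast
      then show ?thesis using card_Un_le by metis
    qed
    ultimately show False
      using node.hyps(2) by (simp add: add_mult_distrib)
  qed
qed

text \<open>Fewer than \<open>m * Suc (card F)\<close> children in \<open>W\<close> are big, as
  otherwise \<open>F\<close> would be, and at most \<open>card F\<close> fail to be good. Together
  these are fewer than \<open>Suc m * Suc (card F)\<close>.\<close>

lemma good_child_not_Big:
  assumes "finite F" "good F" "\<not> Big m I F" "\<forall>x\<in>W. child F x" "Suc m * Suc (card F) \<le> card W \<or> infinite W"
  shows "\<exists>x\<in>W. good (insert x F) \<and> \<not> Big m I (insert x F)"
proof (rule ccontr)
  assume contra: "\<not> ?thesis"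
  obtain V where V: "V \<subseteq> W" "finite V" "Suc m * Suc (card F) = card V"
    using assms(5)
  proof
    assume "Suc m * Suc (card F) \<le> card W"
    then show ?thesis using that obtain_subset_with_card_n[of "Suc m * Suc (card F)" W] by metis
  next
    assume "infinite W"
    then show ?thesis using that infinite_arbitrarily_large[of W "Suc m * Suc (card F)"] by metis
  qed
  let ?B = "{x. child F x \<and> \<not> good (insert x F)}" and ?C = "{x \<in> V. Big m I (insert x F)}"
  have "V \<subseteq> ?B \<union> ?C"
    using V(1) assms(4) contra by blast
  then have "card V \<le> card ?B + card ?C"
    using bad_children(1)[OF assms(1,2)] V(2) card_mono[of "?B \<union> ?C" V] card_Un_le[of ?B ?C]
    by fastforce
  moreover have "card ?C < m * Suc (card F)"
    using V(1,2) assms(4) by (intro card_Big_children[OF assms(3)]) auto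
  ultimately show False
    using V(3) bad_children(2)[OF assms(1,2)] by simp
qed

lemma good_extension:
  assumes "finite F" "good F" "\<not> Big m I F"
  shows "\<exists>x. (\<forall>y\<in>F. y < x) \<and> good (insert x F) \<and> \<not> Big m I (insert x F)"
  using good_child_not_Big[OF assms, of "{x. child F x}"] infinite_children[OF assms(1,2)]
  unfolding child_def by auto

text \<open>One descends the tree, choosing at each node a good child that is still not big for
  \<open>I\<close>. The factor \<open>Suc m\<close> leaves room for this choice, and the leaf
  reached makes program \<open>e\<close> halt.\<close>

lemma halting_extension:
  assumes "Big (Suc m) {e} F" "finite F" "good F" "\<not> Big m I F"
  shows "\<exists>G. finite G \<and> endext F G \<and> good G \<and> \<not> Big m I G \<and> halts X e G"
  using assms
proof (induction rule: Big.induct)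
  case (leaf i F)
  then show ?case by (intro exI[of _ F]) simp
next
  case (node W F)
  then obtain x where x: "x \<in> W" "good (insert x F)" "\<not> Big m I (insert x F)"
    using good_child_not_Big[of F m I W] by auto
  then obtain G where "finite G" "endext (insert x F) G" "good G" "\<not> Big m I G" "halts X e G"
    using node by auto
  moreover have "endext F (insert x F)"
    using node.IH x(1) endext_insert unfolding child_def by blast
  ultimately show ?case
    using endext_trans by blast
qed

section \<open>Conditions and one stage of the construction\<close>

definition answer :: "nat \<Rightarrow> nat set \<Rightarrow> bool" where
  "answer e F \<longleftrightarrow> Big (2 ^ Suc e) {e} F"

text \<open>With \<open>m = 2 ^ Suc e - 1\<close>, the question \<open>answer e F\<close> uses the
  factor \<open>m + 1\<close>, and \<open>m + (m + 1)\<close> is the bound of the next stage. So a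
  negative answer fits \<open>Big_union\<close> exactly.\<close>

definition condition :: "nat \<Rightarrow> nat set \<Rightarrow> nat set \<Rightarrow> bool" where
  "condition e F I \<longleftrightarrow> finite F \<and> good F \<and> \<not> Big (2 ^ Suc e - 1) I F"

definition avoid :: "nat \<Rightarrow> nat set \<Rightarrow> nat set \<Rightarrow> nat set" where
  "avoid e F I = (if answer e F then I else insert e I)"

lemma condition_step:
  assumes "condition e F I"
  shows "\<exists>G. endext F G \<and> F \<noteq> G \<and> condition (Suc e) G (avoid e F I) \<and> (answer e F \<longrightarrow> halts X e G)"
proof -
  define m :: nat where "m = 2 ^ Suc e - 1"
  have m: "2 ^ Suc e = Suc m" "2 ^ Suc (Suc e) - 1 = m + Suc m"
    by (simp_all add: m_def)
  have F: "finite F" "good F" "\<not> Big m I F"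
    using assms unfolding condition_def m_def by auto
  obtain G where G: "finite G" "endext F G" "good G" "\<not> Big (m + Suc m) (avoid e F I) G"
    "answer e F \<longrightarrow> halts X e G"
  proof (cases "answer e F")
    case True
    then obtain G where "finite G" "endext F G" "good G" "\<not> Big m I G" "halts X e G"
      using halting_extension F unfolding answer_def m(1) by blast
    then show ?thesis
      using that[of G] True Big_mono[of "m + Suc m" I G m] by (auto simp: avoid_def)
  next
    \<comment> \<open>Smallness of \<open>I\<close> and of \<open>{e}\<close> add up at the next
      bound, so \<open>F\<close> itself can be kept.\<close>
    case False
    then have "\<not> Big (m + Suc m) (I \<union> {e}) F"
      using F(3) Big_union unfolding answer_def m(1) by blast
    then show ?thesis
      using that[of F] False F by (simp add: avoid_def)
  qed
  \<comment> \<open>One more point makes the extension proper, which will make the union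
    infinite.\<close>
  obtain x where x: "\<forall>y\<in>G. y < x" "good (insert x G)" "\<not> Big (m + Suc m) (avoid e F I) (insert x G)"
    using good_extension[OF G(1,3,4)] by blast
  have "endext F (insert x G)"
    using G(2) x(1) endext_insert endext_trans by blast
  moreover have "F \<noteq> insert x G"
    using x(1) G(2) unfolding endext_def by blast
  moreover have "condition (Suc e) (insert x G) (avoid e F I)"
    using x G(1) unfolding condition_def m(2) by simp
  moreover have "answer e F \<longrightarrow> halts X e (insert x G)"
    using G(5) halts_mono endext_insert[OF x(1)] by blast
  ultimately show ?thesis by blast
qed

text \<open>The initial bound is 1, so \<open>not_Big_empty\<close> applies.\<close>

lemma condition_0: "condition 0 {} {}"
  unfolding condition_def good_def rainbow_def pairs_def using not_Big_empty by force

text \<open>The verification, separated from how the sequence is computed: the answer given at stage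
  \<open>e\<close> already settles whether \<open>e\<close> enters the jump.\<close>

lemma rainbow_and_jump:
  fixes F I :: "nat \<Rightarrow> nat set"
  assumes cond: "\<And>e. condition e (F e) (I e)"
    and ext: "\<And>e. endext (F e) (F (Suc e))" "\<And>e. F e \<noteq> F (Suc e)"
    and I: "\<And>e. I (Suc e) = avoid e (F e) (I e)"
    and halt: "\<And>e. answer e (F e) \<Longrightarrow> halts X e (F (Suc e))"
  defines "R \<equiv> \<Union>e. F e"
  shows "infinite R" "rainbow f R" "e \<in> jump (join X R) \<longleftrightarrow> answer e (F e)"
proof -
  have mono: "endext (F n) (F m)" if "n \<le> m" for n m
    using that by (induction rule: dec_induct) (auto intro: endext_trans ext(1))
  have sub: "F n \<subseteq> F m" if "n \<le> m" for n m
    using mono[OF that] unfolding endext_def by blast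
  have R: "endext (F n) R" for n
    unfolding endext_def
  proof (intro conjI ballI)
    show "F n \<subseteq> R" unfolding R_def by blast
    fix x y assume "x \<in> R - F n" "y \<in> F n"
    then obtain k where k: "x \<in> F k" "x \<notin> F n" unfolding R_def by blast
    then have "n \<le> k" using sub by (meson in_mono nat_le_linear)
    then show "y < x" using mono[of n k] k \<open>y \<in> F n\<close> unfolding endext_def by blast
  qed
  have card: "n \<le> card (F n)" for n
  proof (induction n)
    case (Suc n)
    have "F n \<subset> F (Suc n)" using sub[of n "Suc n"] ext(2) by auto
    then have "card (F n) < card (F (Suc n))"
      using cond[of "Suc n"] by (intro psubset_card_mono) (auto simp: condition_def)
    with Suc show ?case by simp
  qed simp
  show inf: "infinite R"
  proof
    assume "finite R"
    then have "card (F (Suc (card R))) \<le> card R"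
      using R[of "Suc (card R)"] unfolding endext_def by (intro card_mono) auto
    with card[of "Suc (card R)"] show False by simp
  qed
  show "rainbow f R"
    unfolding rainbow_iff
  proof (intro ballI impI)
    fix x s x' s' assume m: "x \<in> R" "s \<in> R" "x' \<in> R" "s' \<in> R"
      and h: "x < s \<and> x' < s' \<and> f x s = f x' s'"
    obtain n1 n2 n3 n4 where "x \<in> F n1" "s \<in> F n2" "x' \<in> F n3" "s' \<in> F n4"
      using m unfolding R_def by blast
    then have "x \<in> F (n1 + n2 + n3 + n4)" "s \<in> F (n1 + n2 + n3 + n4)"
      "x' \<in> F (n1 + n2 + n3 + n4)" "s' \<in> F (n1 + n2 + n3 + n4)"
      using sub[of n1 "n1 + n2 + n3 + n4"] sub[of n2 "n1 + n2 + n3 + n4"]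
        sub[of n3 "n1 + n2 + n3 + n4"] sub[of n4 "n1 + n2 + n3 + n4"] by auto
    moreover have "rainbow f (F (n1 + n2 + n3 + n4))"
      using cond unfolding condition_def good_def by blast
    ultimately show "x = x' \<and> s = s'"
      using h unfolding rainbow_iff by blast
  qed
  have Imono: "I n \<subseteq> I m" if "n \<le> m" for n m
    using that by (induction rule: dec_induct) (auto simp: I avoid_def)
  show "e \<in> jump (join X R) \<longleftrightarrow> answer e (F e)"
  proof
    assume "answer e (F e)"
    then show "e \<in> jump (join X R)"
      using halts_imp_jump[OF R] halt by blast
  next
    assume "e \<in> jump (join X R)"
    then obtain u where u: "\<And>G. endext G R \<Longrightarrow> \<exists>y\<in>G. u \<le> y \<Longrightarrow> halts X e G"
      using jump_imp_halts by blast
    obtain y where "y \<in> R" "u \<le> y"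
      using inf unfolding finite_nat_set_iff_bounded_le by (meson nat_le_linear)
    then obtain n where "y \<in> F n" unfolding R_def by blast
    \<comment> \<open>Stage \<open>k\<close> is late enough to see the halting and lies past the
      stage that decides whether \<open>e\<close> is avoided.\<close>
    define k where "k = max n (Suc e)"
    have "y \<in> F k" using \<open>y \<in> F n\<close> sub[of n k] by (auto simp: k_def)
    then have "halts X e (F k)" using u[OF R] \<open>u \<le> y\<close> by blast
    \<comment> \<open>If \<open>e\<close> were avoided, its halting would make \<open>F k\<close> a
      leaf for \<open>I k\<close>, hence big.\<close>
    then have "e \<notin> I k"
      using cond[of k] Big.leaf unfolding condition_def by blast
    then have "e \<notin> I (Suc e)"
      using Imono[of "Suc e" k] by (auto simp: k_def)
    then show "answer e (F e)"
      by (auto simp: I avoid_def split: if_splits)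
  qed
qed

end

section \<open>Effectivity of the construction\<close>

lemma Dec_Ball_set [rec_intros]:
  assumes "Dec A (\<lambda>z. P (pi1 z) (pi2 z))" "Rec A b"
  shows "Dec A (\<lambda>x. \<forall>y\<in>set_decode (b x). P x y)"
proof -
  have "Rec A (\<lambda>z. b (pi1 z))"
    by (rule Rec_comp[OF assms(2) Rec_pi1[OF Rec_id]])
  then have "Dec A (\<lambda>x. \<forall>y<b x. y \<in> set_decode (b x) \<longrightarrow> P x y)"
    using assms by (intro rec_intros)
  moreover have "(\<forall>y<b x. y \<in> set_decode (b x) \<longrightarrow> P x y) \<longleftrightarrow> (\<forall>y\<in>set_decode (b x). P x y)" for x
    using set_decode_less by blast
  ultimately show ?thesis by simp
qed

lemma Dec_Bex_set [rec_intros]: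
  assumes "Dec A (\<lambda>z. P (pi1 z) (pi2 z))" "Rec A b"
  shows "Dec A (\<lambda>x. \<exists>y\<in>set_decode (b x). P x y)"
proof -
  have "Dec A (\<lambda>x. \<not> (\<forall>y\<in>set_decode (b x). \<not> P x y))"
    using assms by (intro rec_intros)
  then show ?thesis by simp
qed

lemma CE_halts_part:
  "CE X (\<lambda>z. halts X (pi1 z) (set_decode (pi2 z)))"
proof -
  have "Dec X (\<lambda>z. part X (set_decode (pi1 z)) (pi1 (pi2 z)) (pi2 (pi2 z)))"
  proof -
    have "Dec X (\<lambda>z. (even (pi1 (pi2 z)) \<or> (\<exists>y\<in>set_decode (pi1 z). pi1 (pi2 z) div 2 \<le> y)) \<and>
        pi2 (pi2 z) = of_bool (even (pi1 (pi2 z)) \<and> pi1 (pi2 z) div 2 \<in> X \<or>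
          \<not> even (pi1 (pi2 z)) \<and> pi1 (pi2 z) div 2 \<in> set_decode (pi1 z)))"
      by (intro rec_intros)
    moreover have "part X F z b \<longleftrightarrow> (even z \<or> (\<exists>y\<in>F. z div 2 \<le> y)) \<and>
        b = of_bool (even z \<and> z div 2 \<in> X \<or> \<not> even z \<and> z div 2 \<in> F)" for F z b
      unfolding part_def in_join_iff by simp
    ultimately show ?thesis by simp
  qed
  from CE_halts[of X "\<lambda>F. part X (set_decode F)", OF this] show ?thesis
    unfolding halts_def .
qed

context stable_coloring
begin

lemma Rec_f_comp: "Rec X a \<Longrightarrow> Rec X b \<Longrightarrow> Rec X (\<lambda>x. f (a x) (b x))"
  using Rec_comp[OF Rec_f Rec_pr[of X a b]] by simp

lemma Dec_rainbow: "Rec X b \<Longrightarrow> Dec X (\<lambda>x. rainbow f (set_decode (b x)))"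
proof (rule Dec_comp[where P = "\<lambda>n. rainbow f (set_decode n)"])
  show "Dec X (\<lambda>n. rainbow f (set_decode n))"
    unfolding rainbow_iff by (intro rec_intros Rec_f_comp)
qed

lemma Dec_child: "Rec X a \<Longrightarrow> Rec X b \<Longrightarrow> Dec X (\<lambda>x. child (set_decode (a x)) (b x))"
proof (rule Dec_comp2[where P = "\<lambda>n y. child (set_decode n) y"])
  have "Dec X (\<lambda>z. (\<forall>y\<in>set_decode (pi1 z). y < pi2 z) \<and> rainbow f (set_decode (ins (pi2 z) (pi1 z))))"
    by (intro rec_intros Dec_rainbow)
  then show "Dec X (\<lambda>z. child (set_decode (pi1 z)) (pi2 z))"
    by (simp add: child_def)
qed

text \<open>\<open>Q\<close> is the decidable matrix of \<open>halts\<close>, so \<open>w\<close>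
  pairs a program from \<open>I\<close> with a witness of its halting. The first sum is the
  cardinality of the set coded by \<open>F\<close>; the second counts the children whose statements
  are already derived.\<close>

definition big_step :: "(nat \<Rightarrow> nat \<Rightarrow> bool) \<Rightarrow> nat \<Rightarrow> nat \<Rightarrow> nat \<Rightarrow> nat \<Rightarrow> nat \<Rightarrow> bool" where
  "big_step Q S m I F w \<longleftrightarrow>
     (pi1 w \<in> set_decode I \<and> Q (pr (pi1 w) F) (pi2 w)) \<or>
     m * Suc (\<Sum>y<F. of_bool (y \<in> set_decode F)) \<le>
       (\<Sum>x<S. of_bool (child (set_decode F) x \<and> pr m (pr I (ins x F)) \<in> set_decode S))"

definition big_rule :: "(nat \<Rightarrow> nat \<Rightarrow> bool) \<Rightarrow> nat \<Rightarrow> nat \<Rightarrow> nat \<Rightarrow> bool" where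
  "big_rule Q S t w = big_step Q S (pi1 t) (pi1 (pi2 t)) (pi2 (pi2 t)) w"

lemma sum_of_bool: "(\<Sum>y<n. of_bool (P y) :: nat) = card {y. y < n \<and> P y}" for n :: nat
proof (induction n)
  case (Suc n)
  have "{y. y < Suc n \<and> P y} = (if P n then insert n {y. y < n \<and> P y} else {y. y < n \<and> P y})"
    by (auto simp: less_Suc_eq)
  with Suc show ?case by simp
qed simp

lemma sum_set_decode: "(\<Sum>y<F. of_bool (y \<in> set_decode F)) = card (set_decode F)"
proof -
  have "{y. y < F \<and> y \<in> set_decode F} = set_decode F"
    using set_decode_less by blast
  then show ?thesis by (simp add: sum_of_bool)
qed

lemma derivable_big_rule:
  assumes Q: "\<And>z. halts X (pi1 z) (set_decode (pi2 z)) \<longleftrightarrow> (\<exists>y. Q z y)"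
  shows "derivable (big_rule Q) (pr m (pr I F)) \<longleftrightarrow> Big m (set_decode I) (set_decode F)"
proof
  show "Big m (set_decode I) (set_decode F)" if "derivable (big_rule Q) (pr m (pr I F))"
    using that
  proof (induction "pr m (pr I F)" arbitrary: F rule: derivable.induct)
    case (infer S w)
    then have "big_step Q S m I F w" by (simp add: big_rule_def)
    then consider "pi1 w \<in> set_decode I" "Q (pr (pi1 w) F) (pi2 w)"
      | "m * Suc (card (set_decode F)) \<le>
          card {x. x < S \<and> child (set_decode F) x \<and> pr m (pr I (ins x F)) \<in> set_decode S}"
      unfolding big_step_def sum_of_bool sum_set_decode[unfolded sum_of_bool] by blast
    then show ?case
    proof cases
      case 1
      then have "halts X (pi1 w) (set_decode F)"
        using Q[of "pr (pi1 w) F"] by auto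
      with 1(1) show ?thesis by (rule Big.leaf)
    next
      case 2
      show ?thesis
      proof (rule Big.node[OF _ 2])
        show "\<forall>x\<in>{x. x < S \<and> child (set_decode F) x \<and> pr m (pr I (ins x F)) \<in> set_decode S}.
            child (set_decode F) x \<and> Big m (set_decode I) (insert x (set_decode F))"
          using infer.hyps(1) by (metis (mono_tags, lifting) mem_Collect_eq set_decode_ins)
      qed simp
    qed
  qed
next
  have "\<forall>F. G = set_decode F \<longrightarrow> derivable (big_rule Q) (pr m (pr I F))" if "Big m (set_decode I) G" for G
    using that
  proof (induction rule: Big.induct)
    case (leaf i G)
    show ?case
    proof (intro allI impI)
      fix F assume "G = set_decode F"
      then obtain y where "Q (pr i F) y"
        using leaf(2) Q[of "pr i F"] by auto
      then have "big_rule Q (set_encode {}) (pr m (pr I F)) (pr i y)"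
        using leaf(1) by (simp add: big_rule_def big_step_def)
      then show "derivable (big_rule Q) (pr m (pr I F))"
        by (rule derivableI[rotated 2]) auto
    qed
  next
    case (node W G)
    show ?case
    proof (intro allI impI)
      fix F assume G: "G = set_decode F"
      define U where "U = (\<lambda>x. pr m (pr I (ins x F))) ` W"
      have U: "finite U" using node.hyps(1) by (simp add: U_def)
      \<comment> \<open>The bound \<open>x < S\<close> in \<open>big_step\<close> therefore omits no
        child from \<open>W\<close>.\<close>
      have "x < set_encode U" if "x \<in> W" for x
      proof -
        have "x \<in> set_decode (ins x F)" by simp
        then have "x < ins x F" by (rule set_decode_less)
        also have "ins x F \<le> pr I (ins x F)" by (rule le_prod_encode_2)
        also have "\<dots> \<le> pr m (pr I (ins x F))" by (rule le_prod_encode_2)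
        also have "\<dots> < set_encode U"
          by (rule set_decode_less) (use U that in \<open>simp add: U_def\<close>)
        finally show ?thesis .
      qed
      then have "W \<subseteq> {x. x < set_encode U \<and> child (set_decode F) x \<and>
          pr m (pr I (ins x F)) \<in> set_decode (set_encode U)}"
        using node.IH U G by (auto simp: U_def)
      then have "card W \<le> card {x. x < set_encode U \<and> child (set_decode F) x \<and>
          pr m (pr I (ins x F)) \<in> set_decode (set_encode U)}"
        by (intro card_mono) simp_all
      with node.hyps(2) have "big_step Q (set_encode U) m I F 0"
        unfolding big_step_def sum_set_decode sum_of_bool G by linarith
      then have "big_rule Q (set_encode U) (pr m (pr I F)) 0"
        by (simp add: big_rule_def)
      moreover have "derivable (big_rule Q) u" if u: "u \<in> U" for u
      proof -
        from u obtain x where "x \<in> W" "u = pr m (pr I (ins x F))" unfolding U_def by blast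
        with node.IH G show ?thesis by (metis set_decode_ins)
      qed
      ultimately show "derivable (big_rule Q) (pr m (pr I F))"
        using derivableI[OF U] by blast
    qed
  qed
  then show "Big m (set_decode I) (set_decode F) \<Longrightarrow> derivable (big_rule Q) (pr m (pr I F))"
    by blast
qed

lemma CE_Big: "CE X (\<lambda>z. Big (pi1 z) (set_decode (pi1 (pi2 z))) (set_decode (pi2 (pi2 z))))"
proof -
  obtain Q where Q: "Dec X (\<lambda>z. Q (pi1 z) (pi2 z))"
    and eq: "\<And>z. halts X (pi1 z) (set_decode (pi2 z)) \<longleftrightarrow> (\<exists>y. Q z y)"
    using CE_halts_part[of X] unfolding CE_def by blast
  have "CE X (derivable (big_rule Q))"
  proof (rule CE_derivable)
    show "Dec X (\<lambda>z. big_rule Q (pi1 z) (pi1 (pi2 z)) (pi2 (pi2 z)))"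
      unfolding big_rule_def big_step_def by (intro rec_intros Dec_child Dec_comp2[OF Q])
  next
    fix S S' t w assume h: "big_rule Q S t w" and sub: "set_decode S \<subseteq> set_decode S'"
    have "(\<Sum>x<S. of_bool (P x \<and> g x \<in> set_decode S)) \<le> (\<Sum>x<S'. of_bool (P x \<and> g x \<in> set_decode S') :: nat)"
      for P and g :: "nat \<Rightarrow> nat"
      unfolding sum_of_bool
      using sub set_decode_le[OF sub] by (intro card_mono) auto
    with h show "big_rule Q S' t w"
      unfolding big_rule_def big_step_def by (meson order_trans)
  qed
  moreover have "derivable (big_rule Q) = (\<lambda>z. Big (pi1 z) (set_decode (pi1 (pi2 z))) (set_decode (pi2 (pi2 z))))"
    using derivable_big_rule[OF eq, of "pi1 z" "pi1 (pi2 z)" "pi2 (pi2 z)" for z] by (simp add: fun_eq_iff)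
  ultimately show ?thesis by simp
qed

section \<open>What the jump of \<open>X\<close> can decide and compute\<close>

lemma Dec_jump: "Dec X P \<Longrightarrow> Dec (jump X) P"
  by (rule Dec_trans[OF _ turing_le_jump])

lemma Dec_Big:
  assumes "Rec (jump X) a" "Rec (jump X) b" "Rec (jump X) c"
  shows "Dec (jump X) (\<lambda>x. Big (a x) (set_decode (b x)) (set_decode (c x)))"
  by (rule Dec_comp3[where P = "\<lambda>m I F. Big m (set_decode I) (set_decode F)", OF CE_jump[OF CE_Big] assms])

lemma Dec_halts:
  assumes "Rec (jump X) a" "Rec (jump X) b"
  shows "Dec (jump X) (\<lambda>x. halts X (a x) (set_decode (b x)))"
  by (rule Dec_comp2[where P = "\<lambda>e F. halts X e (set_decode F)", OF CE_jump[OF CE_halts_part] assms])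

text \<open>By stability, from some threshold on there are only agreements or only disagreements.
  The jump recognizes such a threshold, as it decides whether a later agreement or disagreement
  exists, and searches for the least one.\<close>

lemma Dec_sim:
  assumes "Rec (jump X) a" "Rec (jump X) b"
  shows "Dec (jump X) (\<lambda>x. sim (a x) (b x))"
proof -
  define E where "E x y s0 \<longleftrightarrow> (\<exists>s. s0 < s \<and> f x s = f y s)" for x y s0
  define D where "D x y s0 \<longleftrightarrow> (\<exists>s. s0 < s \<and> f x s \<noteq> f y s)" for x y s0
  have E: "Dec (jump X) (\<lambda>z. E (pi1 z) (pi1 (pi2 z)) (pi2 (pi2 z)))"
    unfolding E_def by (intro CE_jump CE_ex rec_intros Rec_f_comp)
  have D: "Dec (jump X) (\<lambda>z. D (pi1 z) (pi1 (pi2 z)) (pi2 (pi2 z)))"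
    unfolding D_def by (intro CE_jump CE_ex rec_intros Rec_f_comp)
  define L where "L x y = (LEAST s0. \<not> D x y s0 \<or> \<not> E x y s0)" for x y
  have ex: "\<exists>s0. \<not> D x y s0 \<or> \<not> E x y s0" for x y
    using stable_cases[of x y] unfolding D_def E_def by blast
  have L: "Rec (jump X) (\<lambda>z. L (pi1 z) (pi2 z))"
    unfolding L_def
    by (intro rec_intros ex Dec_comp3[where P = D, OF D] Dec_comp3[where P = E, OF E])
  have "sim x y \<longleftrightarrow> \<not> D x y (L x y)" for x y
  proof
    assume "sim x y"
    then obtain s0 where s0: "\<forall>s>s0. f x s = f y s" unfolding sim_def by blast
    \<comment> \<open>Eventually equal colors agree again beyond every threshold, so the search can
      have stopped only for lack of disagreements.\<close>
    have "E x y (L x y)"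
      unfolding E_def using s0 by (intro exI[of _ "Suc (max s0 (L x y))"]) auto
    then show "\<not> D x y (L x y)"
      using LeastI_ex[OF ex[of x y]] unfolding L_def by blast
  next
    assume "\<not> D x y (L x y)"
    then show "sim x y" unfolding sim_def D_def by blast
  qed
  moreover have "Dec (jump X) (\<lambda>z. \<not> D (pi1 z) (pi2 z) (L (pi1 z) (pi2 z)))"
    by (intro rec_intros Dec_comp3[where P = D, OF D] L)
  ultimately have "Dec (jump X) (\<lambda>z. sim (pi1 z) (pi2 z))" by simp
  then show ?thesis using assms by (rule Dec_comp2)
qed

lemma Dec_good:
  assumes "Rec (jump X) a"
  shows "Dec (jump X) (\<lambda>x. good (set_decode (a x)))"
proof -
  have "Dec (jump X) (\<lambda>n. rainbow f (set_decode n))"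
    by (intro Dec_jump Dec_rainbow rec_intros)
  then have "Dec (jump X) (\<lambda>n. good (set_decode n))"
    unfolding good_def by (intro rec_intros Dec_sim)
  then show ?thesis using assms by (rule Dec_comp)
qed

text \<open>The premise of \<open>nextp\<close> only makes the search for \<open>G\<close> total.\<close>

definition nextp :: "nat \<Rightarrow> nat \<Rightarrow> nat \<Rightarrow> nat \<Rightarrow> bool" where
  "nextp e F I G \<longleftrightarrow> (condition e (set_decode F) (set_decode I) \<longrightarrow>
     endext (set_decode F) (set_decode G) \<and> F \<noteq> G \<and>
     condition (Suc e) (set_decode G) (avoid e (set_decode F) (set_decode I)) \<and>
     (answer e (set_decode F) \<longrightarrow> halts X e (set_decode G)))"

definition avoidc :: "nat \<Rightarrow> nat \<Rightarrow> nat \<Rightarrow> nat" where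
  "avoidc e F I = (if answer e (set_decode F) then I else ins e I)"

lemma set_decode_avoidc: "set_decode (avoidc e F I) = avoid e (set_decode F) (set_decode I)"
  by (simp add: avoidc_def avoid_def)

lemma nextp_ex: "\<exists>G. nextp e F I G"
proof (cases "condition e (set_decode F) (set_decode I)")
  case True
  then obtain G where G: "endext (set_decode F) G" "set_decode F \<noteq> G"
    "condition (Suc e) G (avoid e (set_decode F) (set_decode I))"
    "answer e (set_decode F) \<longrightarrow> halts X e G"
    using condition_step by blast
  then have "set_decode (set_encode G) = G"
    by (intro set_encode_inverse) (simp add: condition_def)
  with G have "nextp e F I (set_encode G)"
    unfolding nextp_def by auto
  then show ?thesis ..
qed (auto simp: nextp_def)

lemma Dec_answer:
  assumes "Rec (jump X) a" "Rec (jump X) b"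
  shows "Dec (jump X) (\<lambda>x. answer (a x) (set_decode (b x)))"
proof -
  \<comment> \<open>\<open>2 ^ a x\<close> is the canonical index of the singleton of
    \<open>a x\<close>.\<close>
  have "Dec (jump X) (\<lambda>x. Big (2 ^ Suc (a x)) (set_decode (2 ^ a x)) (set_decode (b x)))"
    using assms by (intro Dec_Big rec_intros)
  then show ?thesis by (simp add: answer_def)
qed

lemma Rec_avoidc:
  assumes "Rec (jump X) a" "Rec (jump X) b" "Rec (jump X) c"
  shows "Rec (jump X) (\<lambda>x. avoidc (a x) (b x) (c x))"
  unfolding avoidc_def using assms by (intro rec_intros Dec_answer)

lemma Dec_condition:
  assumes "Rec (jump X) a" "Rec (jump X) b" "Rec (jump X) c"
  shows "Dec (jump X) (\<lambda>x. condition (a x) (set_decode (b x)) (set_decode (c x)))"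
proof -
  have "Dec (jump X) (\<lambda>x. good (set_decode (b x)) \<and>
      \<not> Big (2 ^ Suc (a x) - 1) (set_decode (c x)) (set_decode (b x)))"
    using assms by (intro Dec_Big Dec_good rec_intros)
  then show ?thesis by (simp add: condition_def)
qed

lemma Dec_endext:
  assumes "Rec A a" "Rec A b"
  shows "Dec A (\<lambda>x. endext (set_decode (a x)) (set_decode (b x)))"
proof (rule Dec_comp2[where P = "\<lambda>F G. endext (set_decode F) (set_decode G)", OF _ assms])
  have "Dec A (\<lambda>z. (\<forall>x\<in>set_decode (pi1 z). x \<in> set_decode (pi2 z)) \<and>
      (\<forall>x\<in>set_decode (pi2 z). x \<in> set_decode (pi1 z) \<or> (\<forall>y\<in>set_decode (pi1 z). y < x)))"
    by (intro rec_intros)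
  moreover have "endext F G \<longleftrightarrow> (\<forall>x\<in>F. x \<in> G) \<and> (\<forall>x\<in>G. x \<in> F \<or> (\<forall>y\<in>F. y < x))" for F G
    unfolding endext_def by blast
  ultimately show "Dec A (\<lambda>z. endext (set_decode (pi1 z)) (set_decode (pi2 z)))" by simp
qed

lemma Rec_next: "Rec (jump X) (\<lambda>z. LEAST G. nextp (pi1 z) (pi1 (pi2 z)) (pi2 (pi2 z)) G)"
  \<comment> \<open>Folding \<open>avoid\<close> into \<open>avoidc\<close> presents it through a
    canonical index, to which the closure rules apply.\<close>
  unfolding nextp_def set_decode_avoidc[symmetric]
  by (intro rec_intros Dec_condition Dec_endext Dec_answer Dec_halts Rec_avoidc
      nextp_ex[unfolded nextp_def set_decode_avoidc[symmetric]])

text \<open>The components index the current rainbow and the set of avoided programs; both start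
  with 0, the index of the empty set.\<close>

definition state :: "nat \<Rightarrow> nat" where
  "state = rec_nat (pr 0 0) (\<lambda>e s. pr (LEAST G. nextp e (pi1 s) (pi2 s) G) (avoidc e (pi1 s) (pi2 s)))"

lemma Rec_state: "Rec (jump X) state"
proof -
  have next': "Rec (jump X) (\<lambda>z. LEAST G. nextp (a z) (b z) (c z) G)"
    if "Rec (jump X) a" "Rec (jump X) b" "Rec (jump X) c" for a b c
    using Rec_comp[OF Rec_next Rec_pr[OF that(1) Rec_pr[OF that(2,3)]]] by simp
  have "Rec (jump X) (\<lambda>e. rec_nat (pr 0 0)
      (\<lambda>e s. pr (LEAST G. nextp e (pi1 s) (pi2 s) G) (avoidc e (pi1 s) (pi2 s))) e)"
    by (intro rec_intros next' Rec_avoidc)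
  then show ?thesis by (simp add: state_def)
qed

text \<open>The jump of \<open>X\<close> computes \<open>state\<close> and decides
  \<open>answer\<close>, so it can read off the jump of \<open>join X R\<close> stage by
  stage.\<close>

lemma low_rainbow:
  "\<exists>R. infinite R \<and> rainbow f R \<and> jump (join X R) \<le>\<^sub>T jump X"
proof -
  define F where "F e = set_decode (pi1 (state e))" for e
  define I where "I e = set_decode (pi2 (state e))" for e
  have I: "I (Suc e) = avoid e (F e) (I e)" for e
    by (simp add: I_def F_def state_def set_decode_avoidc)
  have nxt: "nextp e (pi1 (state e)) (pi2 (state e)) (pi1 (state (Suc e)))" for e
    using LeastI_ex[OF nextp_ex] by (simp add: state_def)
  have cond: "condition e (F e) (I e)" for e
  proof (induction e)
    case 0
    then show ?case using condition_0 by (simp add: F_def I_def state_def)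
  next
    case (Suc e)
    with nxt[of e] show ?case
      unfolding nextp_def I F_def[symmetric] I_def[symmetric] by blast
  qed
  have step: "endext (F e) (F (Suc e))" "F e \<noteq> F (Suc e)" "answer e (F e) \<Longrightarrow> halts X e (F (Suc e))" for e
    using nxt[of e] cond[of e] unfolding nextp_def F_def I_def by (metis set_decode_inverse)+
  define R where "R = (\<Union>e. F e)"
  have R: "infinite R" "rainbow f R" "\<And>e. e \<in> jump (join X R) \<longleftrightarrow> answer e (F e)"
    unfolding R_def using rainbow_and_jump[OF cond step(1,2) I step(3)] by blast+
  have "Dec (jump X) (\<lambda>e. answer e (set_decode (pi1 (state e))))"
    by (intro Dec_answer rec_intros Rec_state)
  then have "jump (join X R) \<le>\<^sub>T jump X"
    unfolding turing_le_iff_Dec R(3) F_def .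
  with R show ?thesis by blast
qed

end

lemma low_rainbow_coloring_set:
  assumes "coloring_set f \<le>\<^sub>T X" "two_bounded f" "weakly_rainbow_stable f"
  shows "\<exists>R. infinite R \<and> rainbow f R \<and> jump (join X R) \<le>\<^sub>T jump X"
proof -
  \<comment> \<open>\<open>coloring_set\<close> determines \<open>f\<close> only for
    \<open>x < s\<close>, while the locale wants a total computable function. On other arguments the
    search stops at once with 0.\<close>
  define g where "g x s = (LEAST c. x < s \<longrightarrow> pr (pr x s) c \<in> coloring_set f)" for x s
  have mem: "pr (pr x s) c \<in> coloring_set f \<longleftrightarrow> x < s \<and> c = f x s" for x s c
    unfolding coloring_set_def pairs_def by auto
  have g: "g x s = f x s" if "x < s" for x s
    unfolding g_def by (rule Least_equality) (use that in \<open>simp_all add: mem\<close>)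
  have "Dec X (\<lambda>x. x \<in> coloring_set f)"
    using assms(1) by (simp add: turing_le_iff_Dec)
  then have dec: "Dec X (\<lambda>x. h x \<in> coloring_set f)" if "Rec X h" for h
    using that by (rule Dec_comp)
  have ex: "\<exists>c. x < s \<longrightarrow> pr (pr x s) c \<in> coloring_set f" for x s
    by (simp add: mem)
  have "Rec X (\<lambda>z. g (pi1 z) (pi2 z))"
    unfolding g_def by (intro rec_intros dec ex)
  moreover have "two_bounded g"
  proof -
    have "{(x, s) \<in> pairs UNIV. g x s = y} = {(x, s) \<in> pairs UNIV. f x s = y}" for y
      using g by (auto simp: pairs_def)
    with assms(2) show ?thesis by (simp add: two_bounded_def)
  qed
  moreover have "weakly_rainbow_stable g"
  proof -
    have "{s. x < s \<and> y < s \<and> g x s \<noteq> g y s} = {s. x < s \<and> y < s \<and> f x s \<noteq> f y s}"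
      "{s. x < s \<and> y < s \<and> g x s = g y s} = {s. x < s \<and> y < s \<and> f x s = f y s}" for x y
      using g by auto
    with assms(3) show ?thesis by (simp add: weakly_rainbow_stable_def)
  qed
  ultimately interpret stable_coloring X g
    by unfold_locales
  have "rainbow g R \<longleftrightarrow> rainbow f R" for R
    unfolding rainbow_def by (rule inj_on_cong) (auto simp: pairs_def g)
  then show ?thesis using low_rainbow by simp
qed

section \<open>The model\<close>

lemma turing_le_join: "A \<le>\<^sub>T join A B" "B \<le>\<^sub>T join A B"
proof -
  have "Dec (join A B) (\<lambda>x. 2 * x \<in> join A B)" "Dec (join A B) (\<lambda>x. 2 * x + 1 \<in> join A B)"
    by (intro rec_intros)+
  then show "A \<le>\<^sub>T join A B" "B \<le>\<^sub>T join A B"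
    by (simp_all add: turing_le_iff_Dec in_join_iff)
qed

lemma join_turing_le:
  assumes "A \<le>\<^sub>T C" "B \<le>\<^sub>T C" shows "join A B \<le>\<^sub>T C"
proof -
  have A: "Dec C (\<lambda>x. h x \<in> A)" and B: "Dec C (\<lambda>x. h x \<in> B)" if "Rec C h" for h
    using assms that Dec_comp unfolding turing_le_iff_Dec by blast+
  have "Dec C (\<lambda>x. even x \<and> x div 2 \<in> A \<or> \<not> even x \<and> x div 2 \<in> B)"
    by (intro rec_intros A B)
  then show ?thesis
    by (simp add: turing_le_iff_Dec in_join_iff if_bool_eq_disj)
qed

lemma turing_le_refl: "A \<le>\<^sub>T A"
  unfolding turing_le_iff_Dec by (intro rec_intros)

text \<open>Every \<open>e\<close> yields a set, whether or not the program is total, so all pairs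
  of a stage and an index can be treated uniformly.\<close>

definition computed_by :: "nat set \<Rightarrow> nat \<Rightarrow> nat set" where
  "computed_by A e = {x. Phi A e x 1}"

lemma turing_le_imp_computed_by: "B \<le>\<^sub>T A \<Longrightarrow> \<exists>e. B = computed_by A e"
proof -
  assume "B \<le>\<^sub>T A"
  then obtain e where e: "\<And>x. Phi A e x (if x \<in> B then 1 else 0)"
    unfolding turing_le_def by blast
  have "x \<in> B \<longleftrightarrow> Phi A e x 1" for x
  proof
    show "x \<in> B \<Longrightarrow> Phi A e x 1" using e[of x] by simp
    assume "Phi A e x 1"
    with e[of x] have "(if x \<in> B then 1 else 0) = (1::nat)"
      unfolding Phi_def using computes_deterministic inj_code_number[THEN injD] by metis
    then show "x \<in> B" by (simp split: if_splits)
  qed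
  then show ?thesis unfolding computed_by_def by blast
qed

text \<open>The jump bound is unconditional, so the chain stays low even at steps where
  \<open>C\<close> codes no suitable coloring.\<close>

definition solves :: "nat set \<Rightarrow> nat set \<Rightarrow> nat set \<Rightarrow> bool" where
  "solves A C R \<longleftrightarrow> jump (join A R) \<le>\<^sub>T jump A \<and>
     (\<forall>f. coloring_set f = C \<and> C \<le>\<^sub>T A \<and> two_bounded f \<and> weakly_rainbow_stable f \<longrightarrow>
       infinite R \<and> rainbow f R)"

lemma solves_ex: "\<exists>R. solves A C R"
proof (cases "\<exists>f. coloring_set f = C \<and> C \<le>\<^sub>T A \<and> two_bounded f \<and> weakly_rainbow_stable f")
  case True
  then obtain f where f: "coloring_set f = C" "C \<le>\<^sub>T A" "two_bounded f" "weakly_rainbow_stable f"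
    by blast
  then obtain R where R: "infinite R" "rainbow f R" "jump (join A R) \<le>\<^sub>T jump A"
    using low_rainbow_coloring_set[of f A] by auto
  \<comment> \<open>Colorings with the same set agree on all pairs \<open>x < s\<close>, so one
    \<open>R\<close> serves all of them.\<close>
  have "rainbow g R" if "coloring_set g = C" for g
  proof -
    have mem: "pr (pr x s) c \<in> coloring_set h \<longleftrightarrow> x < s \<and> c = h x s" for h x s c
      unfolding coloring_set_def pairs_def by auto
    have "g x s = f x s" if "x < s" for x s
      using mem[of x s "f x s" g] mem[of x s "f x s" f] that f(1) \<open>coloring_set g = C\<close> by simp
    then have "rainbow g R \<longleftrightarrow> rainbow f R"
      unfolding rainbow_def by (intro inj_on_cong) (auto simp: pairs_def)
    with R(2) show ?thesis by simp
  qed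
  with R show ?thesis unfolding solves_def by blast
next
  case False
  \<comment> \<open>With no coloring to solve, the empty set is a harmless choice.\<close>
  have "Dec A (\<lambda>x. x \<in> {})"
    unfolding empty_iff by (rule Dec_const)
  then have "{} \<le>\<^sub>T A"
    by (simp only: turing_le_iff_Dec)
  then have "jump (join A {}) \<le>\<^sub>T jump A"
    by (intro jump_mono join_turing_le turing_le_refl)
  with False show ?thesis unfolding solves_def by blast
qed

text \<open>Since \<open>i \<le> pr i e\<close>, the coloring coded by the \<open>e\<close>-th set computable from \<open>chain i\<close> is still
  computable from \<open>chain (pr i e)\<close>.\<close>

function chain :: "nat \<Rightarrow> nat set" where
  "chain 0 = {}"
| "chain (Suc n) = join (chain n) (SOME R. solves (chain n) (computed_by (chain (pi1 n)) (pi2 n)) R)"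
  by pat_completeness auto
termination
proof (relation "measure id")
  show "(pi1 n, Suc n) \<in> measure id" for n
    using le_prod_encode_1[of "pi1 n" "pi2 n"] by simp
qed auto

lemma chain_mono: "n \<le> m \<Longrightarrow> chain n \<le>\<^sub>T chain m"
proof (induction rule: dec_induct)
  case (step m)
  then show ?case
    using turing_le_trans[OF _ turing_le_join(1)] by simp
qed (rule turing_le_refl)

lemma low_chain: "low (chain n)"
proof (induction n)
  case 0
  then show ?case by (simp add: low_def turing_le_refl)
next
  case (Suc n)
  have "jump (chain (Suc n)) \<le>\<^sub>T jump (chain n)"
    using someI_ex[OF solves_ex] unfolding chain.simps solves_def by blast
  with Suc show ?case
    unfolding low_def by (rule turing_le_trans[rotated])
qed

lemma chain_rainbow:
  assumes "coloring_set f \<le>\<^sub>T chain i" "two_bounded f" "weakly_rainbow_stable f"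
  shows "\<exists>n R. R \<le>\<^sub>T chain n \<and> infinite R \<and> rainbow f R"
proof -
  obtain e where e: "coloring_set f = computed_by (chain i) e"
    using turing_le_imp_computed_by[OF assms(1)] by blast
  define n where "n = pr i e"
  define R where "R = (SOME R. solves (chain n) (coloring_set f) R)"
  have "chain (Suc n) = join (chain n) R"
    by (simp add: R_def n_def e)
  then have "R \<le>\<^sub>T chain (Suc n)"
    using turing_le_join(2) by simp
  moreover have "infinite R \<and> rainbow f R"
  proof -
    have "i \<le> n"
      unfolding n_def by (rule le_prod_encode_1)
    then have "coloring_set f \<le>\<^sub>T chain n"
      using assms(1) chain_mono turing_le_trans by blast
    moreover have "solves (chain n) (coloring_set f) R"
      unfolding R_def by (rule someI_ex[OF solves_ex])
    ultimately show ?thesis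
      using assms(2,3) unfolding solves_def by blast
  qed
  ultimately show ?thesis by blast
qed

theorem corollary6p10:
  "\<exists>M :: nat set set. omega_model_RCA0 M \<and> models_WSRRT22 M \<and> (\<forall>A\<in>M. low A)"
proof -
  \<comment> \<open>In this lower cone of an increasing chain, two sets have a common bound in the
    chain, and each coloring lies below a single member, where \<open>chain_rainbow\<close> handles
    it.\<close>
  define M where "M = {B. \<exists>n. B \<le>\<^sub>T chain n}"
  have M: "B \<in> M \<longleftrightarrow> (\<exists>n. B \<le>\<^sub>T chain n)" for B
    by (simp add: M_def)
  have "join A B \<in> M" if AB: "A \<in> M" "B \<in> M" for A B
  proof -
    obtain n m where nm: "A \<le>\<^sub>T chain n" "B \<le>\<^sub>T chain m"
      using AB unfolding M by blast
    have "A \<le>\<^sub>T chain (max n m)" "B \<le>\<^sub>T chain (max n m)"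
      using nm by (auto intro: turing_le_trans[OF _ chain_mono])
    then show ?thesis
      unfolding M using join_turing_le by blast
  qed
  moreover have "B \<in> M" if "A \<in> M" "B \<le>\<^sub>T A" for A B
    using that turing_le_trans unfolding M by blast
  moreover have "M \<noteq> {}"
    using turing_le_refl M by blast
  ultimately have "omega_model_RCA0 M"
    unfolding omega_model_RCA0_def turing_ideal_def by blast
  moreover have "models_WSRRT22 M"
    unfolding models_WSRRT22_def
  proof (intro allI impI)
    fix f assume f: "coloring_set f \<in> M \<and> two_bounded f \<and> weakly_rainbow_stable f"
    then obtain i where "coloring_set f \<le>\<^sub>T chain i"
      unfolding M by blast
    with f obtain n R where "R \<le>\<^sub>T chain n" "infinite R \<and> rainbow f R"
      using chain_rainbow by blast
    then show "\<exists>R\<in>M. infinite R \<and> rainbow f R"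
      unfolding Bex_def M by blast
  qed
  moreover have "\<forall>A\<in>M. low A"
    using low_chain low_downward unfolding Ball_def M by blast
  ultimately show ?thesis by blast
qed

end
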